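(* Let a $\mathcal{W}_1$-manifold $(M,P,g)$ admit a natural connection $\nabla'$, determined by a pair of real parameters $(\lambda,\mu)$, with parallel torsion and whose curvature tensor $R'$ is a Riemannian $P$-tensor. Then all possible cases are as follows: (i) $\lambda=\mu=0$, $W\neq0$, i.e. $\nabla'=D$, $(M,P,g)\notin\overline{\mathcal{W}}_3$ and $(M,P,g)\notin\overline{\mathcal{W}}_6$; (ii) $\lambda=\mu=0$, $W=0$, i.e. $\nabla'=D$, and $(M,P,g)\in\overline{\mathcal{W}}_3$ or $(M,P,g)\in\overline{\mathcal{W}}_6$; (iii) $\lambda=0$, $\mu\neq0$, $W=0$, i.e. $\nabla'$ belongs to the 1-parametric family of natural connections with $\lambda=0$, and $(M,P,g)\in\overline{\mathcal{W}}_3$ or $(M,P,g)\in\overline{\mathcal{W}}_6$; (iv) $\lambda\neq0$, $\mu=0$, $W=0$, i.e. $\nabla'$ belongs to the 1-parametric family of natural connections with $\mu=0$, and $(M,P,g)\in\overline{\mathcal{W}}_3$ or $(M,P,g)\in\overline{\mathcal{W}}_6$.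
   Context: Setting. A Riemannian almost product manifold $(M,P,g)$ is a differentiable manifold $M$ with a $(1,1)$-tensor field $P$ and a Riemannian metric $g$ such that $P^2x=x$ and $g(Px,Py)=g(x,y)$. Throughout $\operatorname{tr}P=0$ and $\dim M=2n$; $x,y,z,w$ are arbitrary smooth vector fields (or tangent vectors). Let $\nabla$ be the Levi-Civita connection of $g$, $F(x,y,z)=g((\nabla_xP)y,z)$, and $\theta(x)=g^{ij}F(e_i,e_j,x)$, where $\{e_i\}$ is a basis of the tangent space and $(g^{ij})$ is the inverse matrix of $(g(e_i,e_j))$. $(M,P,g)$ is a $\mathcal{W}_1$-manifold if $$F(x,y,z)=\tfrac{1}{2n}\{g(x,y)\theta(z)-g(x,Py)\theta(Pz)+g(x,z)\theta(y)-g(x,Pz)\theta(Py)\}.$$ The vector field $\Omega$ is defined by $g(\Omega,x)=\theta(x)$. The tensor $W$ is $W(y,z)=\theta(Py)\theta(z)-\theta(y)\theta(Pz)$. Subclasses of $\mathcal{W}_1$. $\overline{\mathcal{W}}_3$: $F(x,y,z)=\frac1{2n}\{[g(x,y)+g(x,Py)]\theta(z)+[g(x,z)+g(x,Pz)]\theta(y)\}$ and $\theta(Px)=-\theta(x)$. $\overline{\mathcal{W}}_6$: $F(x,y,z)=\frac1{2n}\{[g(x,y)-g(x,Py)]\theta(z)+[g(x,z)-g(x,Pz)]\theta(y)\}$ and $\theta(Px)=\theta(x)$. Natural connections. A linear connection $\nabla'$ is natural if $\nabla'P=\nabla'g=0$. The natural connections considered on a $\mathcal{W}_1$-manifold form a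 2-parametric family with parameters $\lambda,\mu\in\mathbb{R}$; the one determined by $(\lambda,\mu)$ is $$\nabla'_xy=\nabla_xy+g(x,Py)\{\lambda P\Omega+\mu\Omega\}-\{\lambda\theta(Py)+\mu\theta(y)\}Px+g(x,y)\{\lambda\Omega+(\mu+\tfrac1{2n})P\Omega\}-\{\lambda\theta(y)+(\mu+\tfrac1{2n})\theta(Py)\}x.$$ $D$ denotes the connection with $\lambda=\mu=0$. The torsion is $T(x,y)=\nabla'_xy-\nabla'_yx-[x,y]$; it is parallel if $\nabla'T=0$. Curvature. $R'(x,y)z=\nabla'_x\nabla'_yz-\nabla'_y\nabla'_xz-\nabla'_{[x,y]}z$, $R'(x,y,z,w)=g(R'(x,y)z,w)$. A $(0,4)$-tensor $L$ is a Riemannian $P$-tensor if $L(x,y,z,w)=-L(y,x,z,w)=-L(x,y,w,z)$, $L(x,y,z,w)+L(y,z,x,w)+L(z,x,y,w)=0$, and $L(x,y,Pz,Pw)=L(x,y,z,w)$.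
   Formalization: M is assumed connected, and the cases (i)–(iv) are asserted for some pair (λ,μ) determining ∇', not necessarily the given one: when θ=0 (e.g. flat M) every pair gives the same ∇', so λ=μ=1 meets all hypotheses but none of the cases. *)

theory Defs
  imports "HOL-Analysis.Analysis" "HOL-Library.Function_Algebras"
begin

section \<open>Smooth manifolds\<close>

text \<open>Meant for open \<open>S\<close> in a finite-dimensional space, where continuity of all iterated
  directional derivatives up to order \<open>k\<close> is the usual notion of class \<open>k\<close>.\<close>

primrec Ck_on ::
  "nat \<Rightarrow> 'e::real_normed_vector set \<Rightarrow> ('e \<Rightarrow> 'f::real_normed_vector) \<Rightarrow> bool"
where
  "Ck_on 0 S f \<longleftrightarrow> continuous_on S f"
| "Ck_on (Suc k) S f \<longleftrightarrow>
     (\<forall>x\<in>S. f differentiable (at x)) \<and>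
     (\<forall>v. Ck_on k S (\<lambda>x. frechet_derivative f (at x) v))"

definition Cinf_on ::
  "'e::real_normed_vector set \<Rightarrow> ('e \<Rightarrow> 'f::real_normed_vector) \<Rightarrow> bool"
where "Cinf_on S f \<longleftrightarrow> (\<forall>k. Ck_on k S f)"

text \<open>The manifold is a whole (Hausdorff, second countable) type \<open>'a\<close>, with charts into
  \<open>real^'m\<close>; its dimension is therefore \<open>CARD('m)\<close>.\<close>

type_synonym ('a, 'm) chart = "'a set \<times> ('a \<Rightarrow> real^'m)"

definition is_chart :: "('a::topological_space, 'm::finite) chart \<Rightarrow> bool"
where "is_chart = (\<lambda>(U, \<phi>).
  open U \<and> open (\<phi> ` U) \<and> homeomorphism U (\<phi> ` U) \<phi> (inv_into U \<phi>))"

definition smooth_atlas ::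
  "('a::{t2_space,second_countable_topology}, 'm::finite) chart set \<Rightarrow> bool"
where "smooth_atlas A \<longleftrightarrow>
  (\<forall>c\<in>A. is_chart c) \<and> (\<Union>(U, \<phi>)\<in>A. U) = UNIV \<and>
  (\<forall>(U, \<phi>)\<in>A. \<forall>(V, \<psi>)\<in>A. Cinf_on (\<phi> ` (U \<inter> V)) (\<psi> \<circ> inv_into U \<phi>))"

definition smooth_functions ::
  "('a::{t2_space,second_countable_topology}, 'm::finite) chart set \<Rightarrow> ('a \<Rightarrow> real) set"
where "smooth_functions A =
  {f. \<forall>(U, \<phi>)\<in>A. Cinf_on (\<phi> ` U) (f \<circ> inv_into U \<phi>)}"

section \<open>Tangent vectors and vector fields\<close>

text \<open>Tangent vectors and vector fields are derivations of the algebra of smooth functions.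
  Setting them to zero on non-smooth arguments makes each of them a unique HOL function, so
  that \<open>=\<close> is equality of tangent vectors and of vector fields. Sums, differences and products
  of functions are taken pointwise, as in \<open>Function_Algebras\<close>.\<close>

type_synonym 'a vfield = "('a \<Rightarrow> real) \<Rightarrow> ('a \<Rightarrow> real)"

definition tangent_space ::
  "('a::{t2_space,second_countable_topology}, 'm::finite) chart set \<Rightarrow> 'a
    \<Rightarrow> (('a \<Rightarrow> real) \<Rightarrow> real) set"
where "tangent_space A p = {v.
  (\<forall>f\<in>smooth_functions A. \<forall>h\<in>smooth_functions A. v (f + h) = v f + v h) \<and>
  (\<forall>f\<in>smooth_functions A. \<forall>c. v (\<lambda>q. c * f q) = c * v f) \<and>
  (\<forall>f\<in>smooth_functions A. \<forall>h\<in>smooth_functions A. v (f * h) = f p * v h + h p * v f) \<and>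
  (\<forall>f. f \<notin> smooth_functions A \<longrightarrow> v f = 0)}"

definition vector_fields ::
  "('a::{t2_space,second_countable_topology}, 'm::finite) chart set \<Rightarrow> 'a vfield set"
where "vector_fields A = {X.
  (\<forall>f\<in>smooth_functions A. X f \<in> smooth_functions A) \<and>
  (\<forall>f\<in>smooth_functions A. \<forall>h\<in>smooth_functions A. X (f + h) = X f + X h) \<and>
  (\<forall>f\<in>smooth_functions A. \<forall>c. X (\<lambda>q. c * f q) = (\<lambda>q. c * X f q)) \<and>
  (\<forall>f\<in>smooth_functions A. \<forall>h\<in>smooth_functions A. X (f * h) = f * X h + h * X f) \<and>
  (\<forall>f. f \<notin> smooth_functions A \<longrightarrow> X f = 0)}"

definition vscale :: "('a \<Rightarrow> real) \<Rightarrow> 'a vfield \<Rightarrow> 'a vfield"  (infixr "\<odot>" 75)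
where "f \<odot> X = (\<lambda>h. f * X h)"

definition cscale :: "real \<Rightarrow> 'a vfield \<Rightarrow> 'a vfield"
where "cscale c X = (\<lambda>_. c) \<odot> X"

definition at_point :: "'a vfield \<Rightarrow> 'a \<Rightarrow> (('a \<Rightarrow> real) \<Rightarrow> real)"
where "at_point X p = (\<lambda>f. X f p)"

definition lie_bracket :: "'a vfield \<Rightarrow> 'a vfield \<Rightarrow> 'a vfield"
where "lie_bracket X Y = (\<lambda>f. X (Y f) - Y (X f))"

text \<open>Smooth vector fields whose values at \<open>p\<close> form a basis of the tangent space at \<open>p\<close>:
  every tangent vector at \<open>p\<close> has a unique coordinate vector \<open>c\<close>.\<close>

definition frame_at ::
  "('a::{t2_space,second_countable_topology}, 'm::finite) chart set \<Rightarrow> 'a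
    \<Rightarrow> ('m \<Rightarrow> 'a vfield) \<Rightarrow> bool"
where "frame_at A p E \<longleftrightarrow>
  (\<forall>i. E i \<in> vector_fields A) \<and>
  (\<forall>v\<in>tangent_space A p. \<exists>!c::real^'m. v = (\<lambda>f. \<Sum>i\<in>UNIV. c $ i * at_point (E i) p f))"

section \<open>Tensor fields, metrics and connections\<close>

text \<open>Tensor fields are maps on vector fields that are linear over the smooth functions.\<close>

type_synonym 'a oneform = "'a vfield \<Rightarrow> ('a \<Rightarrow> real)"
type_synonym 'a metric = "'a vfield \<Rightarrow> 'a vfield \<Rightarrow> ('a \<Rightarrow> real)"
type_synonym 'a endo = "'a vfield \<Rightarrow> 'a vfield"
type_synonym 'a conn = "'a vfield \<Rightarrow> 'a vfield \<Rightarrow> 'a vfield"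

definition riemannian_metric ::
  "('a::{t2_space,second_countable_topology}, 'm::finite) chart set \<Rightarrow> 'a metric \<Rightarrow> bool"
where "riemannian_metric A g \<longleftrightarrow>
  (\<forall>X\<in>vector_fields A. \<forall>Y\<in>vector_fields A.
     g X Y \<in> smooth_functions A \<and> g X Y = g Y X \<and>
     (\<forall>Z\<in>vector_fields A. g (X + Y) Z = g X Z + g Y Z) \<and>
     (\<forall>f\<in>smooth_functions A. g (f \<odot> X) Y = f * g X Y)) \<and>
  (\<forall>X\<in>vector_fields A. \<forall>p. at_point X p \<noteq> 0 \<longrightarrow> g X X p > 0)"

definition endomorphism_field ::
  "('a::{t2_space,second_countable_topology}, 'm::finite) chart set \<Rightarrow> 'a endo \<Rightarrow> bool"
where "endomorphism_field A P \<longleftrightarrow>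
  (\<forall>X\<in>vector_fields A. P X \<in> vector_fields A \<and>
     (\<forall>Y\<in>vector_fields A. P (X + Y) = P X + P Y) \<and>
     (\<forall>f\<in>smooth_functions A. P (f \<odot> X) = f \<odot> P X))"

definition riemannian_almost_product ::
  "('a::{t2_space,second_countable_topology}, 'm::finite) chart set
    \<Rightarrow> 'a endo \<Rightarrow> 'a metric \<Rightarrow> bool"
where "riemannian_almost_product A P g \<longleftrightarrow>
  smooth_atlas A \<and> endomorphism_field A P \<and> riemannian_metric A g \<and>
  (\<forall>X\<in>vector_fields A. P (P X) = X) \<and>
  (\<forall>X\<in>vector_fields A. \<forall>Y\<in>vector_fields A. g (P X) (P Y) = g X Y)"

text \<open>\<open>a\<close> is the matrix of \<open>P\<close> at \<open>p\<close> in the frame \<open>E\<close>; its trace does not depend on \<open>E\<close>.\<close>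

definition trace_zero ::
  "('a::{t2_space,second_countable_topology}, 'm::finite) chart set \<Rightarrow> 'a endo \<Rightarrow> bool"
where "trace_zero A P \<longleftrightarrow>
  (\<forall>p E. \<forall>a::real^'m^'m. frame_at A p E \<and>
     (\<forall>j. at_point (P (E j)) p = (\<lambda>f. \<Sum>i\<in>UNIV. a $ i $ j * at_point (E i) p f))
     \<longrightarrow> trace a = 0)"

definition linear_connection ::
  "('a::{t2_space,second_countable_topology}, 'm::finite) chart set \<Rightarrow> 'a conn \<Rightarrow> bool"
where "linear_connection A nab \<longleftrightarrow>
  (\<forall>X\<in>vector_fields A. \<forall>Y\<in>vector_fields A.
     nab X Y \<in> vector_fields A \<and>
     (\<forall>Z\<in>vector_fields A. nab (X + Y) Z = nab X Z + nab Y Z \<and> nab Z (X + Y) = nab Z X + nab Z Y) \<and>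
     (\<forall>f\<in>smooth_functions A. nab (f \<odot> X) Y = f \<odot> nab X Y \<and>
                             nab X (f \<odot> Y) = X f \<odot> Y + f \<odot> nab X Y))"

definition torsion :: "'a conn \<Rightarrow> 'a vfield \<Rightarrow> 'a vfield \<Rightarrow> 'a vfield"
where "torsion nab X Y = nab X Y - nab Y X - lie_bracket X Y"

definition cov_deriv_endo :: "'a conn \<Rightarrow> 'a endo \<Rightarrow> 'a vfield \<Rightarrow> 'a vfield \<Rightarrow> 'a vfield"
where "cov_deriv_endo nab P X Y = nab X (P Y) - P (nab X Y)"

definition cov_deriv_metric ::
  "'a conn \<Rightarrow> 'a metric \<Rightarrow> 'a vfield \<Rightarrow> 'a vfield \<Rightarrow> 'a vfield \<Rightarrow> ('a \<Rightarrow> real)"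
where "cov_deriv_metric nab g X Y Z = X (g Y Z) - g (nab X Y) Z - g Y (nab X Z)"

definition cov_deriv_12 ::
  "'a conn \<Rightarrow> ('a vfield \<Rightarrow> 'a vfield \<Rightarrow> 'a vfield)
    \<Rightarrow> 'a vfield \<Rightarrow> 'a vfield \<Rightarrow> 'a vfield \<Rightarrow> 'a vfield"
where "cov_deriv_12 nab S X Y Z = nab X (S Y Z) - S (nab X Y) Z - S Y (nab X Z)"

definition metric_connection ::
  "('a::{t2_space,second_countable_topology}, 'm::finite) chart set
    \<Rightarrow> 'a metric \<Rightarrow> 'a conn \<Rightarrow> bool"
where "metric_connection A g nab \<longleftrightarrow>
  (\<forall>X\<in>vector_fields A. \<forall>Y\<in>vector_fields A. \<forall>Z\<in>vector_fields A. cov_deriv_metric nab g X Y Z = 0)"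

definition levi_civita ::
  "('a::{t2_space,second_countable_topology}, 'm::finite) chart set
    \<Rightarrow> 'a metric \<Rightarrow> 'a conn \<Rightarrow> bool"
where "levi_civita A g nab \<longleftrightarrow>
  linear_connection A nab \<and> metric_connection A g nab \<and>
  (\<forall>X\<in>vector_fields A. \<forall>Y\<in>vector_fields A. torsion nab X Y = 0)"

definition natural_connection ::
  "('a::{t2_space,second_countable_topology}, 'm::finite) chart set
    \<Rightarrow> 'a endo \<Rightarrow> 'a metric \<Rightarrow> 'a conn \<Rightarrow> bool"
where "natural_connection A P g nab' \<longleftrightarrow>
  linear_connection A nab' \<and> metric_connection A g nab' \<and>
  (\<forall>X\<in>vector_fields A. \<forall>Y\<in>vector_fields A. cov_deriv_endo nab' P X Y = 0)"

definition parallel_torsion ::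
  "('a::{t2_space,second_countable_topology}, 'm::finite) chart set \<Rightarrow> 'a conn \<Rightarrow> bool"
where "parallel_torsion A nab' \<longleftrightarrow>
  (\<forall>X\<in>vector_fields A. \<forall>Y\<in>vector_fields A. \<forall>Z\<in>vector_fields A.
     cov_deriv_12 nab' (torsion nab') X Y Z = 0)"

definition curvature :: "'a conn \<Rightarrow> 'a vfield \<Rightarrow> 'a vfield \<Rightarrow> 'a vfield \<Rightarrow> 'a vfield"
where "curvature nab X Y Z =
  nab X (nab Y Z) - nab Y (nab X Z) - nab (lie_bracket X Y) Z"

definition curvature4 ::
  "'a metric \<Rightarrow> 'a conn \<Rightarrow> 'a vfield \<Rightarrow> 'a vfield \<Rightarrow> 'a vfield \<Rightarrow> 'a vfield \<Rightarrow> ('a \<Rightarrow> real)"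
where "curvature4 g nab X Y Z U = g (curvature nab X Y Z) U"

definition riemannian_P_tensor ::
  "('a::{t2_space,second_countable_topology}, 'm::finite) chart set \<Rightarrow> 'a endo
    \<Rightarrow> ('a vfield \<Rightarrow> 'a vfield \<Rightarrow> 'a vfield \<Rightarrow> 'a vfield \<Rightarrow> ('a \<Rightarrow> real)) \<Rightarrow> bool"
where "riemannian_P_tensor A P L \<longleftrightarrow>
  (\<forall>X\<in>vector_fields A. \<forall>Y\<in>vector_fields A. \<forall>Z\<in>vector_fields A. \<forall>U\<in>vector_fields A.
     L X Y Z U = - L Y X Z U \<and>
     L X Y Z U = - L X Y U Z \<and>
     L X Y Z U + L Y Z X U + L Z X Y U = 0 \<and>
     L X Y (P Z) (P U) = L X Y Z U)"

section \<open>The class \<open>W\<^sub>1\<close> and its natural connections\<close>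

definition F_tensor ::
  "'a endo \<Rightarrow> 'a metric \<Rightarrow> 'a conn \<Rightarrow> 'a vfield \<Rightarrow> 'a vfield \<Rightarrow> 'a vfield \<Rightarrow> ('a \<Rightarrow> real)"
where "F_tensor P g nab X Y Z = g (cov_deriv_endo nab P X Y) Z"

text \<open>The value at \<open>p\<close> is a metric trace, so it does not depend on the chosen frame.\<close>

definition theta ::
  "('a::{t2_space,second_countable_topology}, 'm::finite) chart set
    \<Rightarrow> 'a endo \<Rightarrow> 'a metric \<Rightarrow> 'a conn \<Rightarrow> 'a oneform"
where "theta A P g nab X p =
  (let E = (SOME E. frame_at A p E);
       G = (\<chi> i j. g (E i) (E j) p) :: real^'m^'m
   in \<Sum>i\<in>UNIV. \<Sum>j\<in>UNIV. matrix_inv G $ i $ j * F_tensor P g nab (E i) (E j) X p)"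

definition W1_manifold ::
  "('a::{t2_space,second_countable_topology}, 'm::finite) chart set \<Rightarrow> nat
    \<Rightarrow> 'a endo \<Rightarrow> 'a metric \<Rightarrow> 'a conn \<Rightarrow> bool"
where "W1_manifold A n P g nab \<longleftrightarrow>
  (let \<theta> = theta A P g nab in
   \<forall>X\<in>vector_fields A. \<forall>Y\<in>vector_fields A. \<forall>Z\<in>vector_fields A. \<forall>p.
     F_tensor P g nab X Y Z p = 1 / (2 * real n) *
       (g X Y p * \<theta> Z p - g X (P Y) p * \<theta> (P Z) p
        + g X Z p * \<theta> Y p - g X (P Z) p * \<theta> (P Y) p))"

definition W3bar ::
  "('a::{t2_space,second_countable_topology}, 'm::finite) chart set \<Rightarrow> nat
    \<Rightarrow> 'a endo \<Rightarrow> 'a metric \<Rightarrow> 'a conn \<Rightarrow> bool"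
where "W3bar A n P g nab \<longleftrightarrow>
  (let \<theta> = theta A P g nab in
   (\<forall>X\<in>vector_fields A. \<forall>Y\<in>vector_fields A. \<forall>Z\<in>vector_fields A. \<forall>p.
     F_tensor P g nab X Y Z p = 1 / (2 * real n) *
       ((g X Y p + g X (P Y) p) * \<theta> Z p + (g X Z p + g X (P Z) p) * \<theta> Y p)) \<and>
   (\<forall>X\<in>vector_fields A. \<theta> (P X) = - \<theta> X))"

definition W6bar ::
  "('a::{t2_space,second_countable_topology}, 'm::finite) chart set \<Rightarrow> nat
    \<Rightarrow> 'a endo \<Rightarrow> 'a metric \<Rightarrow> 'a conn \<Rightarrow> bool"
where "W6bar A n P g nab \<longleftrightarrow>
  (let \<theta> = theta A P g nab in
   (\<forall>X\<in>vector_fields A. \<forall>Y\<in>vector_fields A. \<forall>Z\<in>vector_fields A. \<forall>p.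
     F_tensor P g nab X Y Z p = 1 / (2 * real n) *
       ((g X Y p - g X (P Y) p) * \<theta> Z p + (g X Z p - g X (P Z) p) * \<theta> Y p)) \<and>
   (\<forall>X\<in>vector_fields A. \<theta> (P X) = \<theta> X))"

definition theta_dual ::
  "('a::{t2_space,second_countable_topology}, 'm::finite) chart set
    \<Rightarrow> 'a endo \<Rightarrow> 'a metric \<Rightarrow> 'a conn \<Rightarrow> 'a vfield \<Rightarrow> bool"
where "theta_dual A P g nab \<Omega> \<longleftrightarrow>
  \<Omega> \<in> vector_fields A \<and> (\<forall>X\<in>vector_fields A. g \<Omega> X = theta A P g nab X)"

definition W_tensor ::
  "('a::{t2_space,second_countable_topology}, 'm::finite) chart set
    \<Rightarrow> 'a endo \<Rightarrow> 'a metric \<Rightarrow> 'a conn \<Rightarrow> 'a vfield \<Rightarrow> 'a vfield \<Rightarrow> ('a \<Rightarrow> real)"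
where "W_tensor A P g nab Y Z =
  (let \<theta> = theta A P g nab in \<theta> (P Y) * \<theta> Z - \<theta> Y * \<theta> (P Z))"

definition W_zero ::
  "('a::{t2_space,second_countable_topology}, 'm::finite) chart set
    \<Rightarrow> 'a endo \<Rightarrow> 'a metric \<Rightarrow> 'a conn \<Rightarrow> bool"
where "W_zero A P g nab \<longleftrightarrow>
  (\<forall>Y\<in>vector_fields A. \<forall>Z\<in>vector_fields A. W_tensor A P g nab Y Z = 0)"

text \<open>The member of the two-parameter family of natural connections given by
  \<open>(lam, mu)\<close>.\<close>

definition family_connection ::
  "('a::{t2_space,second_countable_topology}, 'm::finite) chart set \<Rightarrow> nat
    \<Rightarrow> 'a endo \<Rightarrow> 'a metric \<Rightarrow> 'a conn \<Rightarrow> 'a vfield \<Rightarrow> real \<Rightarrow> real \<Rightarrow> 'a conn"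
where "family_connection A n P g nab \<Omega> lam mu X Y =
  (let \<theta> = theta A P g nab; k = 1 / (2 * real n) in
   nab X Y
   + g X (P Y) \<odot> (cscale lam (P \<Omega>) + cscale mu \<Omega>)
   - (\<lambda>p. lam * \<theta> (P Y) p + mu * \<theta> Y p) \<odot> P X
   + g X Y \<odot> (cscale lam \<Omega> + cscale (mu + k) (P \<Omega>))
   - (\<lambda>p. lam * \<theta> Y p + (mu + k) * \<theta> (P Y) p) \<odot> X)"

definition D_connection ::
  "('a::{t2_space,second_countable_topology}, 'm::finite) chart set \<Rightarrow> nat
    \<Rightarrow> 'a endo \<Rightarrow> 'a metric \<Rightarrow> 'a conn \<Rightarrow> 'a vfield \<Rightarrow> 'a conn"
where "D_connection A n P g nab \<Omega> = family_connection A n P g nab \<Omega> 0 0"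

text \<open>Connections are HOL functions that are only meaningful on vector fields.\<close>

definition same_connection ::
  "('a::{t2_space,second_countable_topology}, 'm::finite) chart set
    \<Rightarrow> 'a conn \<Rightarrow> 'a conn \<Rightarrow> bool"
where "same_connection A nab1 nab2 \<longleftrightarrow>
  (\<forall>X\<in>vector_fields A. \<forall>Y\<in>vector_fields A. nab1 X Y = nab2 X Y)"

text \<open>The pair \<open>(lam, mu)\<close> determines \<open>nab'\<close>. On some manifolds different pairs determine the same
  connection: every pair gives the Levi-Civita connection if \<open>\<theta> = 0\<close>, only \<open>lam - mu\<close>
  matters on \<open>W3bar\<close>, only \<open>lam + mu\<close> on \<open>W6bar\<close>, and no parameter matters in dimension 2.\<close>

definition determined_by ::
  "('a::{t2_space,second_countable_topology}, 'm::finite) chart set \<Rightarrow> nat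
    \<Rightarrow> 'a endo \<Rightarrow> 'a metric \<Rightarrow> 'a conn \<Rightarrow> 'a vfield \<Rightarrow> 'a conn \<Rightarrow> real \<Rightarrow> real \<Rightarrow> bool"
where "determined_by A n P g nab \<Omega> nab' lam mu \<longleftrightarrow>
  same_connection A nab' (family_connection A n P g nab \<Omega> lam mu)"

end

theory Submission
  imports Defs
begin

text \<open>Write \<open>V s\<close>, for \<open>s = 1\<close> and \<open>s = -1\<close>, for the eigenbundles of \<open>P\<close>; they are orthogonal, and since
\<open>P\<close> has trace zero both have rank \<open>n\<close>. Put \<open>k = 1/(2n)\<close> and let \<open>T\<close> be the torsion of the natural
connection \<open>nab'\<close> with parameters \<open>lam\<close>, \<open>mu\<close>. As \<open>nab\<close> has no torsion, the family formula
gives \<open>T\<close> explicitly, and on eigenvectors it becomes very short: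

\<^item> \<open>T(x, y) = s k (\<theta>(x) y + \<theta>(y) x)\<close> for \<open>x\<close> in \<open>V s\<close> and \<open>y\<close> in \<open>V (-s)\<close>;
\<^item> \<open>T(x, z) = c (\<theta>(x) z - \<theta>(z) x)\<close> with \<open>c = 2 (lam + s mu) + s k\<close> for \<open>x\<close>, \<open>z\<close> in \<open>V s\<close>.

The mixed part does not contain the parameters. A natural connection preserves \<open>V s\<close>, so
differentiating the mixed formula shows that parallel torsion forces \<open>nab' \<Omega> = 0\<close>, whatever the
parameters are (\<open>parallel_Omega\<close>). Hence the squared lengths of the two eigencomponents of \<open>\<Omega>\<close>
are constant on the connected manifold.

If \<open>W = 0\<close>, the product of these two constants is \<open>0\<close>, so one eigencomponent of \<open>\<Omega>\<close> vanishes
identically, that is \<open>P \<Omega> = -\<Omega>\<close> or \<open>P \<Omega> = \<Omega>\<close>. The defining identity of \<open>W\<^sub>1\<close> then turns into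
that of \<open>W3bar\<close> or of \<open>W6bar\<close>, and only \<open>mu - lam\<close> or \<open>mu + lam\<close> influences the connection; so the
pair may be replaced by one whose first entry is \<open>0\<close>.

If \<open>W \<noteq> 0\<close> at some point, \<open>\<theta>\<close> is nonzero there on both eigenspaces. The first Bianchi identities
of a Riemannian \<open>P\<close>-tensor and of a connection with parallel torsion together say that the cyclic
sum of \<open>T(T(x, y), z)\<close> is zero. For \<open>x\<close>, \<open>z\<close> in \<open>V s\<close> and \<open>y\<close> in \<open>V (-s)\<close> this sum is
\<open>2 s k (lam + s mu) \<theta>(y) (\<theta>(x) z - \<theta>(z) x)\<close>. When \<open>n \<ge> 2\<close> there is a nonzero \<open>z\<close> with
\<open>\<theta>(z) = 0\<close>, and \<open>lam + s mu = 0\<close> follows for both signs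
(\<open>parameter_combination_vanishes\<close>). When \<open>n = 1\<close> both eigenbundles are line bundles, a natural
connection is unique, and the pair \<open>(0, 0)\<close> determines it as well as any other
(\<open>surface_parameters_free\<close>).

Vector fields being derivations of the smooth functions, the differential topology behind this
has to be supplied: tangent vectors are combinations of coordinate derivatives (\<open>Hadamard\<close> and
\<open>tangent_vector_partials\<close>), there are enough global vector fields (\<open>local_frame\<close>), and a function
annihilated by all of them is constant (\<open>smooth_constant\<close>).\<close>

section \<open>Differentiability classes\<close>

text \<open>The derivative at a point of \<open>S\<close> is taken over a full neighbourhood, so values outside \<open>S\<close>
matter unless \<open>S\<close> is open; this is why openness recurs below.\<close>

lemma Ck_on_cong:
  assumes "open S" "Ck_on k S f" "\<And>x. x \<in> S \<Longrightarrow> f x = g x"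
  shows "Ck_on k S g"
  using assms(2,3)
proof (induction k arbitrary: f g)
  case 0
  then show ?case by (metis Ck_on.simps(1) continuous_on_cong)
next
  case (Suc k)
  have D: "(g has_derivative frechet_derivative f (at x)) (at x)" if "x \<in> S" for x
  proof -
    have "(f has_derivative frechet_derivative f (at x)) (at x)"
      using Suc.prems(1) that by (simp add: frechet_derivative_works)
    then show ?thesis
      using has_derivative_transform_within_open[of f _ x UNIV S g] assms(1) that Suc.prems(2) by auto
  qed
  show ?case
    unfolding Ck_on.simps
  proof (intro conjI ballI allI)
    fix x assume "x \<in> S" then show "g differentiable at x" using D differentiable_def by blast
  next
    fix v
    show "Ck_on k S (\<lambda>x. frechet_derivative g (at x) v)"
      by (rule Suc.IH[of "\<lambda>x. frechet_derivative f (at x) v"])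
        (use Suc.prems D frechet_derivative_at in \<open>fastforce+\<close>)
  qed
qed

text \<open>Any family of derivatives may be used in place of the chosen one, derivatives being unique.\<close>

lemma Ck_on_SucI:
  assumes "open S" "\<And>x. x \<in> S \<Longrightarrow> (f has_derivative f' x) (at x)"
    "\<And>v. Ck_on k S (\<lambda>x. f' x v)"
  shows "Ck_on (Suc k) S f"
  unfolding Ck_on.simps
proof (intro conjI ballI allI)
  fix x assume "x \<in> S" then show "f differentiable at x" using assms(2) differentiable_def by blast
next
  fix v
  show "Ck_on k S (\<lambda>x. frechet_derivative f (at x) v)"
    by (rule Ck_on_cong[OF assms(1) assms(3)[of v]]) (use assms(2) frechet_derivative_at in metis)
qed

lemma Ck_on_Suc_derivative:
  "Ck_on (Suc k) S f \<Longrightarrow> x \<in> S \<Longrightarrow> (f has_derivative frechet_derivative f (at x)) (at x)"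
  by (simp add: frechet_derivative_works)

lemma Ck_on_subset: "Ck_on k S f \<Longrightarrow> T \<subseteq> S \<Longrightarrow> Ck_on k T f"
  by (induction k arbitrary: f) (auto intro: continuous_on_subset)

lemma Ck_on_Suc_imp: "Ck_on (Suc k) S f \<Longrightarrow> Ck_on k S f"
proof (induction k arbitrary: f)
  case 0
  then show ?case
    by (auto intro!: differentiable_imp_continuous_on differentiable_at_imp_differentiable_on)
qed auto

text \<open>This glues functions given by different formulas on different open sets.\<close>

lemma Ck_on_local:
  assumes "\<And>x. x \<in> S \<Longrightarrow> \<exists>T. open T \<and> x \<in> T \<and> Ck_on k T f"
  shows "Ck_on k S f"
  using assms
proof (induction k arbitrary: f)
  case 0
  show ?case
    unfolding Ck_on.simps
  proof (rule continuous_at_imp_continuous_on, intro ballI)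
    fix x assume "x \<in> S"
    then obtain T where "open T" "x \<in> T" "continuous_on T f" using 0 by force
    then show "isCont f x" using continuous_on_eq_continuous_at by blast
  qed
next
  case (Suc k)
  show ?case unfolding Ck_on.simps
  proof (intro conjI ballI allI)
    fix x assume "x \<in> S" then show "f differentiable at x" using Suc.prems by fastforce
  next
    fix v
    show "Ck_on k S (\<lambda>x. frechet_derivative f (at x) v)"
      by (rule Suc.IH) (use Suc.prems in fastforce)
  qed
qed

lemma Ck_on_const: "Ck_on k S (\<lambda>x. c)"
  by (induction k arbitrary: c) auto

lemma Ck_on_add:
  assumes "open S" "Ck_on k S f" "Ck_on k S g"
  shows "Ck_on k S (\<lambda>x. f x + g x)"
  using assms(2,3)
proof (induction k arbitrary: f g)
  case 0 then show ?case by (auto intro: continuous_intros)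
next
  case (Suc k)
  show ?case
    by (rule Ck_on_SucI[OF assms(1) has_derivative_add[OF Ck_on_Suc_derivative[OF Suc.prems(1)]
          Ck_on_Suc_derivative[OF Suc.prems(2)]]]) (use Suc in auto)
qed

lemma Ck_on_linear:
  assumes "open S" "bounded_linear L" "Ck_on k S f"
  shows "Ck_on k S (\<lambda>x. L (f x))"
  using assms(3)
proof (induction k arbitrary: f)
  case 0 then show ?case using assms(2) by (auto intro: bounded_linear.continuous_on)
next
  case (Suc k)
  show ?case
    by (rule Ck_on_SucI[OF assms(1) bounded_linear.has_derivative[OF assms(2) Ck_on_Suc_derivative[OF Suc.prems(1)]]])
      (use Suc in auto)
qed

lemma Ck_on_mult:
  fixes f g :: "'e::real_normed_vector \<Rightarrow> real"
  assumes "open S" "Ck_on k S f" "Ck_on k S g"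
  shows "Ck_on k S (\<lambda>x. f x * g x)"
  using assms(2,3)
proof (induction k arbitrary: f g)
  case 0 then show ?case by (auto intro: continuous_intros)
next
  case (Suc k)
  show ?case
  proof (rule Ck_on_SucI[OF assms(1) has_derivative_mult[OF Ck_on_Suc_derivative[OF Suc.prems(1)]
          Ck_on_Suc_derivative[OF Suc.prems(2)]]])
    fix v
    show "Ck_on k S (\<lambda>x. f x * frechet_derivative g (at x) v + frechet_derivative f (at x) v * g x)"
      using Suc Ck_on_Suc_imp[OF Suc.prems(1)] Ck_on_Suc_imp[OF Suc.prems(2)]
      by (intro Ck_on_add[OF assms(1)]) auto
  qed
qed

lemma Ck_on_sum:
  assumes "open S" "\<And>i. i \<in> I \<Longrightarrow> Ck_on k S (f i)"
  shows "Ck_on k S (\<lambda>x. \<Sum>i\<in>I. f i x)"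
  using assms(2)
  by (induction I rule: infinite_finite_induct)
    (auto intro!: Ck_on_const Ck_on_add[OF assms(1)])

lemma Ck_on_bounded_linear: "open S \<Longrightarrow> bounded_linear L \<Longrightarrow> Ck_on k S L"
  by (cases k) (auto simp del: Ck_on.simps(2) intro!: Ck_on_SucI[where f'="\<lambda>_. L"] Ck_on_const
      bounded_linear_imp_has_derivative linear_continuous_on)

lemma linear_euclidean_expand:
  fixes L :: "'g::euclidean_space \<Rightarrow> real"
  assumes "linear L" shows "L w = (\<Sum>b\<in>Basis. (w \<bullet> b) * L b)"
proof -
  have "L w = L (\<Sum>b\<in>Basis. (w \<bullet> b) *\<^sub>R b)" by (simp add: euclidean_representation)
  also have "\<dots> = (\<Sum>b\<in>Basis. (w \<bullet> b) * L b)"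
    by (simp add: linear_sum[OF assms] linear_cmul[OF assms])
  finally show ?thesis .
qed

text \<open>In a basis of the middle space the chain rule is a finite sum of products of functions one class
lower, so induction on the class applies.\<close>

lemma Ck_on_compose:
  fixes h :: "'e::real_normed_vector \<Rightarrow> 'g::euclidean_space" and f :: "'g \<Rightarrow> real"
  assumes "open S" "open T" "h ` S \<subseteq> T" "Ck_on k T f" "Ck_on k S h"
  shows "Ck_on k S (\<lambda>x. f (h x))"
  using assms(3-)
proof (induction k arbitrary: f h)
  case 0 then show ?case by (auto intro: continuous_on_compose2)
next
  case (Suc k)
  have D: "((\<lambda>x. f (h x)) has_derivative
      (\<lambda>v. \<Sum>b\<in>Basis. (frechet_derivative h (at x) v \<bullet> b) * frechet_derivative f (at (h x)) b)) (at x)"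
    if "x \<in> S" for x
  proof -
    have hx: "h x \<in> T" using Suc.prems that by auto
    have lin: "linear (frechet_derivative f (at (h x)))"
      using Suc.prems hx by (simp add: linear_frechet_derivative)
    have "((\<lambda>x. f (h x)) has_derivative
      (\<lambda>v. frechet_derivative f (at (h x)) (frechet_derivative h (at x) v))) (at x)"
      using has_derivative_compose[OF Ck_on_Suc_derivative[OF Suc.prems(3) that] Ck_on_Suc_derivative[OF Suc.prems(2) hx]] .
    then show ?thesis by (subst (asm) linear_euclidean_expand[OF lin]) 
  qed
  show ?case
  proof (rule Ck_on_SucI[OF assms(1) D])
    fix v
    show "Ck_on k S (\<lambda>x. \<Sum>b\<in>Basis. (frechet_derivative h (at x) v \<bullet> b) * frechet_derivative f (at (h x)) b)"
    proof (intro Ck_on_sum Ck_on_mult assms(1) Suc.IH[OF Suc.prems(1)])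
      fix b :: 'g
      show "Ck_on k S (\<lambda>x. frechet_derivative h (at x) v \<bullet> b)"
        by (rule Ck_on_linear[OF assms(1), where L="\<lambda>w. w \<bullet> b"]) (use Suc.prems in \<open>auto intro: bounded_linear_inner_left\<close>)
      show "Ck_on k T (\<lambda>x. frechet_derivative f (at x) b)" using Suc.prems by auto
      show "Ck_on k S h" using Ck_on_Suc_imp[OF Suc.prems(3)] .
    qed
  qed
qed

section \<open>Flat functions and cutoffs\<close>

text \<open>The classical function \<open>exp (-1/t)\<close>, extended by zero, is the case \<open>m = 0\<close>. The powers of \<open>1/t\<close>
make the family closed under differentiation up to linear combinations, so that smoothness is
proved for all its members in one induction.\<close>

definition flat_fun :: "nat \<Rightarrow> real \<Rightarrow> real"
  where "flat_fun m t = (if t > 0 then (1/t)^m * exp (-(1/t)) else 0)"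

lemma flat_fun_tendsto_0: "(flat_fun m \<longlongrightarrow> 0) (at 0)"
proof -
  have R: "(flat_fun m \<longlongrightarrow> 0) (at_right 0)"
  proof -
    have "filterlim (\<lambda>t::real. 1/t) at_top (at_right 0)"
      using filterlim_inverse_at_top_right by (simp add: inverse_eq_divide)
    from filterlim_compose[OF tendsto_power_div_exp_0[of m] this]
    have *: "((\<lambda>t::real. (1/t)^m / exp (1/t)) \<longlongrightarrow> 0) (at_right 0)" .
    show ?thesis
      by (rule Lim_transform_eventually[OF *])
        (auto simp: flat_fun_def eventually_at_right_less exp_minus divide_inverse intro: eventually_at_right_less eventually_mono)
  qed
  have L: "(flat_fun m \<longlongrightarrow> 0) (at_left 0)"
    by (rule Lim_transform_eventually[OF tendsto_const])
      (auto simp: flat_fun_def eventually_at_left_field intro!: exI[of _ "-1"])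
  show ?thesis using R L filterlim_split_at by blast
qed

text \<open>At \<open>0\<close> the difference quotient of member \<open>m\<close> is member \<open>m + 1\<close>, which tends to \<open>0\<close>.\<close>

lemma flat_fun_has_derivative:
  "(flat_fun m has_real_derivative flat_fun (m + 2) t - m * flat_fun (m + 1) t) (at t)"
proof -
  consider "t > 0" | "t < 0" | "t = 0" by linarith
  then show ?thesis
  proof cases
    case 1
    have pow: "m * (1/t)^(m - Suc 0) * (1/t)\<^sup>2 = m * (1/t)^(m + 1)"
      by (cases m) (auto simp: power2_eq_square)
    have "((\<lambda>t. (1/t)^m * exp (-(1/t))) has_real_derivative
        m * (1/t)^(m - Suc 0) * (- (1/t)\<^sup>2) * exp (-(1/t)) + exp (-(1/t)) * (1/t)\<^sup>2 * (1/t)^m) (at t)"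
      by (rule derivative_eq_intros refl | use 1 in \<open>simp add: divide_simps power2_eq_square\<close>)+
    also have "m * (1/t)^(m - Suc 0) * (- (1/t)\<^sup>2) * exp (-(1/t)) + exp (-(1/t)) * (1/t)\<^sup>2 * (1/t)^m
        = flat_fun (m + 2) t - m * flat_fun (m + 1) t"
      using pow 1 by (simp add: flat_fun_def power2_eq_square field_simps)
    finally have "((\<lambda>t. (1/t)^m * exp (-(1/t))) has_real_derivative flat_fun (m + 2) t - m * flat_fun (m + 1) t) (at t)" .
    then show ?thesis
      by (rule DERIV_cong_ev[THEN iffD1, rotated 3])
        (use 1 in \<open>auto simp: flat_fun_def eventually_nhds intro!: exI[of _ "{0<..}"]\<close>)
  next
    case 2
    have "((\<lambda>t. 0) has_real_derivative flat_fun (m + 2) t - m * flat_fun (m + 1) t) (at t)"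
      using 2 by (auto simp: flat_fun_def)
    then show ?thesis
      by (rule DERIV_cong_ev[THEN iffD1, rotated 3])
        (use 2 in \<open>auto simp: flat_fun_def eventually_nhds intro!: exI[of _ "{..<0}"]\<close>)
  next
    case 3
    have "(\<lambda>h. (flat_fun m (0 + h) - flat_fun m 0) / h) = flat_fun (m + 1)"
      by (auto simp: flat_fun_def fun_eq_iff)
    then show ?thesis
      using flat_fun_tendsto_0[of "m+1"] by (simp add: 3 DERIV_def flat_fun_def)
  qed
qed

lemma Ck_on_flat_fun: "Ck_on k UNIV (flat_fun m)"
proof (induction k arbitrary: m)
  case 0
  show ?case
    using DERIV_isCont[OF flat_fun_has_derivative] by (simp add: continuous_at_imp_continuous_on)
next
  case (Suc k)
  show ?case
  proof (rule Ck_on_SucI)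
    fix t show "(flat_fun m has_derivative (\<lambda>v. v * (flat_fun (m + 2) t + (- real m) * flat_fun (m + 1) t))) (at t)"
      
      by (rule has_derivative_eq_rhs[OF has_field_derivative_imp_has_derivative[OF flat_fun_has_derivative]])
        (simp add: fun_eq_iff mult.commute)
  next
    fix v
    show "Ck_on k UNIV (\<lambda>t. v * (flat_fun (m + 2) t + (- real m) * flat_fun (m + 1) t))"
      by (intro Ck_on_mult Ck_on_add Ck_on_const Suc) auto
  qed simp
qed

lemma Cinf_on_Ck: "Cinf_on S f \<Longrightarrow> Ck_on k S f" by (simp add: Cinf_on_def)

lemma Cinf_on_zero_extend:
  assumes "open W" "Cinf_on W u" "closed K" "K \<subseteq> W" "\<And>x. x \<notin> K \<Longrightarrow> u x = 0"
  shows "Cinf_on UNIV u"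
  unfolding Cinf_on_def
proof (intro allI Ck_on_local)
  fix k x
  show "\<exists>T. open T \<and> x \<in> T \<and> Ck_on k T u"
  proof (cases "x \<in> K")
    case True then show ?thesis using assms Cinf_on_Ck by blast
  next
    case False
    have "Ck_on k (- K) u"
      by (rule Ck_on_cong[of _ _ "\<lambda>_. 0"]) (use assms in \<open>auto intro: Ck_on_const\<close>)
    then show ?thesis using False assms(3) by blast
  qed
qed

text \<open>The flat function of \<open>r\<^sup>2 - |x - a|\<^sup>2\<close>, normalised at \<open>a\<close>. It need not be constant near \<open>a\<close>:
below only its value at \<open>a\<close> and its support matter.\<close>

lemma ex_cutoff:
  fixes a :: "'e::euclidean_space"
  assumes "open W" "a \<in> W"
  obtains \<beta> K where "Cinf_on UNIV \<beta>" "compact K" "K \<subseteq> W" "\<And>x. x \<notin> K \<Longrightarrow> \<beta> x = (0::real)" "\<beta> a = 1"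
proof -
  obtain r where r: "r > 0" "cball a r \<subseteq> W" using assms open_contains_cball by blast
  define s where "s x = r\<^sup>2 + (-1) * ((x - a) \<bullet> (x - a))" for x
  define \<beta> where "\<beta> x = (1 / flat_fun 0 (r\<^sup>2)) * flat_fun 0 (s x)" for x
  have s: "Ck_on k UNIV s" for k
  proof (cases k)
    case 0 then show ?thesis unfolding s_def by (auto intro!: continuous_intros)
  next
    case (Suc j)
    show ?thesis unfolding Suc
    proof (rule Ck_on_SucI)
      fix x show "(s has_derivative (\<lambda>v. (-2) * (x \<bullet> v + (- (a \<bullet> v))))) (at x)"
        unfolding s_def
        by (rule derivative_eq_intros refl)+ (simp add: fun_eq_iff inner_diff_left inner_diff_right inner_commute algebra_simps)
    next
      fix v :: 'e
      have "Ck_on j UNIV (\<lambda>x. x \<bullet> v)"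
        by (rule Ck_on_bounded_linear) (auto intro: bounded_linear_inner_left)
      then show "Ck_on j UNIV (\<lambda>x. (-2) * (x \<bullet> v + (- (a \<bullet> v))))"
        by (intro Ck_on_mult Ck_on_add Ck_on_const) auto
    qed simp
  qed
  show ?thesis
  proof (rule that)
    show "Cinf_on UNIV \<beta>" unfolding Cinf_on_def \<beta>_def
      by (intro allI Ck_on_mult Ck_on_const Ck_on_compose[OF _ _ _ Ck_on_flat_fun s]) auto
    show "compact (cball a r)" by simp
    show "cball a r \<subseteq> W" by fact
    show "\<beta> a = 1" using r by (simp add: \<beta>_def s_def flat_fun_def)
    fix x assume "x \<notin> cball a r"
    then have "r\<^sup>2 < (norm (x - a))\<^sup>2" using r by (intro power_strict_mono) (auto simp: dist_norm norm_minus_commute)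
    then show "\<beta> x = 0" by (simp add: \<beta>_def s_def flat_fun_def dot_square_norm)
  qed
qed

section \<open>Hadamard's lemma\<close>

text \<open>The coefficients in Hadamard's lemma are such integrals of partial derivatives of \<open>h\<close> with
\<open>m = 0\<close>; each differentiation in \<open>x\<close> brings out one more factor \<open>t\<close>, whence the exponent.\<close>

definition radial_mean :: "'e::euclidean_space \<Rightarrow> nat \<Rightarrow> ('e \<Rightarrow> real) \<Rightarrow> 'e \<Rightarrow> real"
  where "radial_mean a m h x = integral (cbox 0 1) (\<lambda>t. t ^ m * h (a + t *\<^sub>R (x - a)))"

lemma segment_in_convex:
  assumes "convex S" "a \<in> S" "x \<in> S" "t \<in> cbox 0 (1::real)"
  shows "a + t *\<^sub>R (x - a) \<in> S"
proof -
  have "a + t *\<^sub>R (x - a) = (1 - t) *\<^sub>R a + t *\<^sub>R x" by (simp add: algebra_simps)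
  then show ?thesis using assms by (simp add: convex_def)
qed

text \<open>Differentiation under the integral sign.\<close>

lemma radial_mean_has_derivative:
  fixes h :: "'e::euclidean_space \<Rightarrow> real"
  assumes S: "open S" "convex S" "a \<in> S" and h: "Ck_on (Suc 0) S h" and x: "x \<in> S"
  shows "(radial_mean a m h has_derivative
    (\<lambda>v. radial_mean a (Suc m) (\<lambda>y. frechet_derivative h (at y) v) x)) (at x)"
proof -
  define D where "D y = frechet_derivative h (at y)" for y
  have D: "(h has_derivative D y) (at y)" if "y \<in> S" for y
    using h that by (simp add: D_def frechet_derivative_works)
  have contD: "continuous_on S (\<lambda>y. D y v)" for v
    using h by (simp add: D_def)
  have conth: "continuous_on S h"
    using Ck_on_Suc_imp[OF h] by simp
  have cseg: "continuous_on (S \<times> cbox 0 (1::real)) (\<lambda>z. a + snd z *\<^sub>R (fst z - a))"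
    by (intro continuous_intros)
  have seg: "(\<lambda>z. a + snd z *\<^sub>R (fst z - a)) ` (S \<times> cbox 0 (1::real)) \<subseteq> S"
    using segment_in_convex[OF S(2,3)] by auto
  define fx where "fx y t = Blinfun (\<lambda>v. t ^ m * D (a + t *\<^sub>R (y - a)) (t *\<^sub>R v))" for y and t :: real
  have bl: "bounded_linear (\<lambda>v. t ^ m * D (a + t *\<^sub>R (y - a)) (t *\<^sub>R v))" if "y \<in> S" "t \<in> cbox 0 1" for y t
    by (rule bounded_linear_const_mult[OF bounded_linear_compose[OF
            D[OF segment_in_convex[OF S(2,3) that], THEN has_derivative_bounded_linear] bounded_linear_scaleR_right]])
  have fx_apply: "blinfun_apply (fx y t) v = t ^ Suc m * D (a + t *\<^sub>R (y - a)) v" if "y \<in> S" "t \<in> cbox 0 1" for y t v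
  proof -
    have "linear (D (a + t *\<^sub>R (y - a)))"
      using D[OF segment_in_convex[OF S(2,3) that], THEN has_derivative_linear] .
    then show ?thesis
      unfolding fx_def bounded_linear_Blinfun_apply[OF bl[OF that]] by (simp add: linear_cmul)
  qed
  have 1: "((\<lambda>y. t ^ m * h (a + t *\<^sub>R (y - a))) has_derivative blinfun_apply (fx y t)) (at y within S)"
    if "y \<in> S" "t \<in> cbox 0 1" for y t
  proof -
    have g: "((\<lambda>y. a + t *\<^sub>R (y - a)) has_derivative (\<lambda>v. t *\<^sub>R v)) (at y)"
      by (auto intro!: derivative_eq_intros)
    have "((\<lambda>y. t ^ m * h (a + t *\<^sub>R (y - a))) has_derivative (\<lambda>v. t ^ m * D (a + t *\<^sub>R (y - a)) (t *\<^sub>R v))) (at y)"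
      using has_derivative_compose[OF g D[OF segment_in_convex[OF S(2,3) that]]]
      by (rule has_derivative_mult_right)
    then show ?thesis
      unfolding fx_def bounded_linear_Blinfun_apply[OF bl[OF that]]
      by (rule has_derivative_at_withinI)
  qed
  have conth2: "continuous_on (cbox 0 1) (\<lambda>t::real. h (a + t *\<^sub>R (y - a)))" if "y \<in> S" for y
    by (rule continuous_on_compose2[OF conth])
      (use segment_in_convex[OF S(2,3) that] in \<open>auto intro!: continuous_intros\<close>)
  have 2: "(\<lambda>t::real. t ^ m * h (a + t *\<^sub>R (y - a))) integrable_on cbox 0 1" if "y \<in> S" for y
    by (intro integrable_continuous continuous_intros conth2[OF that])
  \<comment> \<open>Norm continuity of a linear map valued function follows from that of its components.\<close>
  have 3: "continuous_on (S \<times> cbox 0 1) (\<lambda>(y, t). fx y t)"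
  proof (rule continuous_on_blinfun_componentwise)
    fix i :: 'e
    have "continuous_on (S \<times> cbox 0 (1::real)) (\<lambda>z. snd z ^ Suc m * D (a + snd z *\<^sub>R (fst z - a)) i)"
      by (intro continuous_intros continuous_on_compose2[OF contD cseg seg])
    then show "continuous_on (S \<times> cbox 0 1) (\<lambda>z. blinfun_apply (case z of (y, t) \<Rightarrow> fx y t) i)"
      by (rule continuous_on_eq) (auto simp: fx_apply)
  qed
  have cfx: "continuous_on (cbox 0 1) (fx x)"
  proof -
    have "continuous_on (cbox 0 1) (\<lambda>t::real. (x, t))" by (intro continuous_intros)
    from continuous_on_compose2[OF 3 this] x show ?thesis by auto
  qed
  have eq: "blinfun_apply (integral (cbox 0 1) (fx x)) = (\<lambda>v. radial_mean a (Suc m) (\<lambda>y. D y v) x)"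
  proof
    fix v
    have "blinfun_apply (integral (cbox 0 1) (fx x)) v = integral (cbox 0 1) (\<lambda>t. blinfun_apply (fx x t) v)"
      using integral_linear[OF integrable_continuous[OF cfx] blinfun.bounded_linear_left[of v]] by (simp add: o_def)
    also have "\<dots> = radial_mean a (Suc m) (\<lambda>y. D y v) x"
      unfolding radial_mean_def by (rule integral_cong) (use fx_apply x in auto)
    finally show "blinfun_apply (integral (cbox 0 1) (fx x)) v = radial_mean a (Suc m) (\<lambda>y. D y v) x" .
  qed
  have "((\<lambda>y. integral (cbox 0 1) (\<lambda>t. t ^ m * h (a + t *\<^sub>R (y - a)))) has_derivative
      blinfun_apply (integral (cbox 0 1) (fx x))) (at x within S)"
    by (rule leibniz_rule[OF 1 2 3 x S(2)])
  then show ?thesis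
    unfolding eq at_within_open[OF x S(1)] radial_mean_def[of a m h, abs_def] D_def .
qed

lemma Ck_on_radial_mean:
  fixes h :: "'e::euclidean_space \<Rightarrow> real"
  assumes S: "open S" "convex S" "a \<in> S" and h: "Cinf_on S h"
  shows "Ck_on k S (radial_mean a m h)"
  using h
proof (induction k arbitrary: m h)
  case 0
  have "radial_mean a m h differentiable at x" if "x \<in> S" for x
    using radial_mean_has_derivative[OF S _ that] 0 by (meson Cinf_on_def differentiable_def)
  then show ?case
    by (auto intro!: differentiable_imp_continuous_on differentiable_at_imp_differentiable_on)
next
  case (Suc k)
  have "Cinf_on S (\<lambda>y. frechet_derivative h (at y) v)" for v
    using Suc.prems unfolding Cinf_on_def by (metis Ck_on.simps(2))
  then show ?case
    using Suc by (intro Ck_on_SucI[OF S(1) radial_mean_has_derivative[OF S]]) (auto simp: Cinf_on_def)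
qed

text \<open>Integrate the derivative of \<open>f\<close> along the segment from \<open>a\<close> to \<open>x\<close> and expand \<open>x - a\<close> in the
basis.\<close>

lemma Hadamard:
  fixes f :: "'e::euclidean_space \<Rightarrow> real"
  assumes S: "open S" "convex S" "a \<in> S" and f: "Cinf_on S f"
  obtains G where "\<And>b. Cinf_on S (G b)"
    "\<And>x. x \<in> S \<Longrightarrow> f x = f a + (\<Sum>b\<in>Basis. ((x - a) \<bullet> b) * G b x)"
    "\<And>b. G b a = frechet_derivative f (at a) b"
proof
  define D where "D y = frechet_derivative f (at y)" for y
  define G where "G b = radial_mean a 0 (\<lambda>y. D y b)" for b
  have Ds: "Cinf_on S (\<lambda>y. D y b)" for b
    using f unfolding Cinf_on_def D_def by (metis Ck_on.simps(2))
  then show "Cinf_on S (G b)" for b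
    unfolding G_def Cinf_on_def[of S "radial_mean a 0 _"] using Ck_on_radial_mean[OF S] by blast
  have D: "(f has_derivative D y) (at y)" if "y \<in> S" for y
    using f that Ck_on_Suc_derivative unfolding Cinf_on_def D_def by blast
  show "G b a = frechet_derivative f (at a) b" for b
    by (simp add: G_def radial_mean_def D_def)
  fix x assume x: "x \<in> S"
  have "((\<lambda>t. D (a + t *\<^sub>R (x - a)) (x - a)) has_integral (f (a + 1 *\<^sub>R (x - a)) - f (a + 0 *\<^sub>R (x - a)))) {0..1}"
  proof (rule fundamental_theorem_of_calculus)
    fix t :: real assume t: "t \<in> {0..1}"
    have g: "((\<lambda>t. a + t *\<^sub>R (x - a)) has_derivative (\<lambda>s. s *\<^sub>R (x - a))) (at t)"
      by (auto intro!: derivative_eq_intros)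
    have sS: "a + t *\<^sub>R (x - a) \<in> S" using segment_in_convex[OF S(2,3) x] t by auto
    have "linear (D (a + t *\<^sub>R (x - a)))" using D[OF sS] has_derivative_linear by blast
    then have "((\<lambda>t. f (a + t *\<^sub>R (x - a))) has_derivative (\<lambda>s. s *\<^sub>R D (a + t *\<^sub>R (x - a)) (x - a))) (at t)"
      using has_derivative_compose[OF g D[OF sS]] by (simp add: linear_cmul)
    then show "((\<lambda>t. f (a + t *\<^sub>R (x - a))) has_vector_derivative D (a + t *\<^sub>R (x - a)) (x - a)) (at t within {0..1})"
      unfolding has_vector_derivative_def by (rule has_derivative_at_withinI)
  qed simp
  then have "f x - f a = integral (cbox 0 1) (\<lambda>t. D (a + t *\<^sub>R (x - a)) (x - a))"
    by (simp add: integral_unique)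
  also have "\<dots> = integral (cbox 0 1) (\<lambda>t. \<Sum>b\<in>Basis. ((x - a) \<bullet> b) * D (a + t *\<^sub>R (x - a)) b)"
  proof (rule integral_cong)
    fix t :: real assume t: "t \<in> cbox 0 1"
    have "linear (D (a + t *\<^sub>R (x - a)))"
      using D[OF segment_in_convex[OF S(2,3) x t]] has_derivative_linear by blast
    then show "D (a + t *\<^sub>R (x - a)) (x - a) = (\<Sum>b\<in>Basis. ((x - a) \<bullet> b) * D (a + t *\<^sub>R (x - a)) b)"
      by (rule linear_euclidean_expand)
  qed
  also have "\<dots> = (\<Sum>b\<in>Basis. integral (cbox 0 1) (\<lambda>t. ((x - a) \<bullet> b) * D (a + t *\<^sub>R (x - a)) b))"
  proof (rule integral_sum)
    fix b :: 'e
    have c: "continuous_on S (\<lambda>y. D y b)" using Ds[of b] unfolding Cinf_on_def by (metis Ck_on.simps(1))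
    show "(\<lambda>t. ((x - a) \<bullet> b) * D (a + t *\<^sub>R (x - a)) b) integrable_on cbox 0 1"
      by (intro integrable_continuous continuous_intros continuous_on_compose2[OF c])
       (use segment_in_convex[OF S(2,3) x] in auto)
  qed simp
  also have "\<dots> = (\<Sum>b\<in>Basis. ((x - a) \<bullet> b) * G b x)"
    by (simp add: G_def radial_mean_def)
  finally show "f x = f a + (\<Sum>b\<in>Basis. ((x - a) \<bullet> b) * G b x)" by simp
qed

section \<open>Smooth functions, tangent vectors and vector fields\<close>

lemma sum_fun_apply: "(\<Sum>i\<in>I. f i) x = (\<Sum>i\<in>I. f i x)"
  by (induction I rule: infinite_finite_induct) auto

lemma sum_Basis_axis: "(\<Sum>b\<in>Basis. h b) = (\<Sum>i\<in>UNIV. h (axis i (1::real) :: real^'m))"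
proof -
  have B: "(Basis :: (real^'m) set) = range (\<lambda>i. axis i 1)"
    by (auto simp: Basis_vec_def)
  have "inj (\<lambda>i. axis i (1::real) :: real^'m)" by (auto simp: inj_def axis_eq_axis)
  then show ?thesis unfolding B by (simp add: sum.reindex)
qed

locale smooth_manifold =
  fixes A :: "('a::{t2_space,second_countable_topology}, 'm::finite) chart set"
  assumes atlas: "smooth_atlas A"
begin

abbreviation "SF \<equiv> smooth_functions A"
abbreviation "VF \<equiv> vector_fields A"

lemma chart_props:
  assumes "(U, \<phi>) \<in> A"
  shows "open U" "open (\<phi> ` U)" "continuous_on U \<phi>" "continuous_on (\<phi> ` U) (inv_into U \<phi>)"
    "q \<in> U \<Longrightarrow> inv_into U \<phi> (\<phi> q) = q" "x \<in> \<phi> ` U \<Longrightarrow> \<phi> (inv_into U \<phi> x) = x"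
    "x \<in> \<phi> ` U \<Longrightarrow> inv_into U \<phi> x \<in> U"
proof -
  have "is_chart (U, \<phi>)" using atlas assms by (auto simp: smooth_atlas_def)
  then have *: "open U" "open (\<phi> ` U)" "homeomorphism U (\<phi> ` U) \<phi> (inv_into U \<phi>)"
    by (auto simp: is_chart_def)
  show "open U" "open (\<phi> ` U)" using * by auto
  show "continuous_on U \<phi>" "continuous_on (\<phi> ` U) (inv_into U \<phi>)"
    "q \<in> U \<Longrightarrow> inv_into U \<phi> (\<phi> q) = q" "x \<in> \<phi> ` U \<Longrightarrow> \<phi> (inv_into U \<phi> x) = x"
    "x \<in> \<phi> ` U \<Longrightarrow> inv_into U \<phi> x \<in> U"
    using *(3) by (auto simp: homeomorphism_def)
qed

lemma chart_transition:
  assumes "(V, \<psi>) \<in> A" "(U, \<phi>) \<in> A"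
  shows "Cinf_on (\<psi> ` (V \<inter> U)) (\<phi> \<circ> inv_into V \<psi>)"
proof -
  have "\<forall>(V, \<psi>)\<in>A. \<forall>(U, \<phi>)\<in>A. Cinf_on (\<psi> ` (V \<inter> U)) (\<phi> \<circ> inv_into V \<psi>)"
    using atlas by (simp add: smooth_atlas_def)
  from bspec[OF this assms(1)] have "\<forall>(U, \<phi>)\<in>A. Cinf_on (\<psi> ` (V \<inter> U)) (\<phi> \<circ> inv_into V \<psi>)"
    by simp
  from bspec[OF this assms(2)] show ?thesis by simp
qed

lemma chart_at: obtains U \<phi> where "(U, \<phi>) \<in> A" "p \<in> U"
proof -
  have "p \<in> (\<Union>(U, \<phi>)\<in>A. U)" using atlas by (auto simp: smooth_atlas_def)
  then show ?thesis using that by auto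
qed

lemma smooth_const: "(\<lambda>_. c) \<in> SF"
  by (auto simp: smooth_functions_def Cinf_on_def o_def Ck_on_const)

lemma smooth_add: "f \<in> SF \<Longrightarrow> h \<in> SF \<Longrightarrow> f + h \<in> SF"
  using chart_props(2) by (fastforce simp: smooth_functions_def Cinf_on_def o_def intro: Ck_on_add)

lemma smooth_mult: "f \<in> SF \<Longrightarrow> h \<in> SF \<Longrightarrow> f * h \<in> SF"
  using chart_props(2) by (fastforce simp: smooth_functions_def Cinf_on_def o_def intro: Ck_on_mult)

lemma smooth_cmult: "f \<in> SF \<Longrightarrow> (\<lambda>q. c * f q) \<in> SF"
  using smooth_mult[OF smooth_const[of c]] by (simp add: times_fun_def)

lemma smooth_uminus: "f \<in> SF \<Longrightarrow> - f \<in> SF"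
  using smooth_cmult[of f "-1"] by (simp add: fun_Compl_def)

lemma smooth_diff: "f \<in> SF \<Longrightarrow> h \<in> SF \<Longrightarrow> f - h \<in> SF"
  using smooth_add[OF _ smooth_uminus[of h]] by simp

lemma smooth_zero: "0 \<in> SF"
  using smooth_const[of 0] by (simp add: zero_fun_def)

lemma smooth_sum: "(\<And>i. i \<in> I \<Longrightarrow> f i \<in> SF) \<Longrightarrow> sum f I \<in> SF"
  by (induction I rule: infinite_finite_induct) (auto intro: smooth_zero smooth_add)

lemma smooth_in_chart: "f \<in> SF \<Longrightarrow> (U, \<phi>) \<in> A \<Longrightarrow> Cinf_on (\<phi> ` U) (f \<circ> inv_into U \<phi>)"
  by (auto simp: smooth_functions_def)

definition extend :: "'a set \<Rightarrow> ('a \<Rightarrow> real^'m) \<Rightarrow> (real^'m \<Rightarrow> real) \<Rightarrow> 'a \<Rightarrow> real"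
  where "extend U \<phi> u = (\<lambda>q. if q \<in> U then u (\<phi> q) else 0)"

text \<open>The preimage of \<open>K\<close> is compact, hence closed because the manifold is Hausdorff; so the extension
is smooth also at boundary points of the chart domain, where it vanishes nearby.\<close>

lemma extend_smooth:
  assumes c: "(U, \<phi>) \<in> A" and u: "Cinf_on UNIV u" and K: "compact K" "K \<subseteq> \<phi> ` U" "\<And>x. x \<notin> K \<Longrightarrow> u x = 0"
  shows "extend U \<phi> u \<in> SF"
  unfolding smooth_functions_def Cinf_on_def
proof (intro CollectI ballI, clarify, rule Ck_on_local)
  fix V \<psi> k x assume d: "(V, \<psi>) \<in> A" and x: "x \<in> \<psi> ` V"
  let ?q = "inv_into V \<psi>"
  have opn: "open (\<psi> ` V \<inter> ?q -` S)" if "open S" for S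
    using chart_props(4,2)[OF d] that by (intro continuous_open_preimage) auto
  show "\<exists>T. open T \<and> x \<in> T \<and> Ck_on k T (extend U \<phi> u \<circ> ?q)"
  proof (cases "?q x \<in> U")
    case True
    let ?T = "\<psi> ` V \<inter> ?q -` U"
    have T: "?T = \<psi> ` (V \<inter> U)"
      using chart_props[OF d] by (auto 0 3)
    have o: "open ?T" using opn chart_props(1)[OF c] by blast
    have "Cinf_on (\<psi> ` (V \<inter> U)) (\<phi> \<circ> ?q)"
      by (rule chart_transition[OF d c])
    then have "Ck_on k ?T (\<phi> \<circ> ?q)"
      unfolding T[symmetric] by (rule Cinf_on_Ck)
    then have "Ck_on k ?T (\<lambda>y. u ((\<phi> \<circ> ?q) y))"
      by (rule Ck_on_compose[OF o open_UNIV subset_UNIV Cinf_on_Ck[OF u]])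
    then have "Ck_on k ?T (extend U \<phi> u \<circ> ?q)"
      by (rule Ck_on_cong[OF o]) (simp add: extend_def)
    then show ?thesis
      by (intro exI[of _ ?T] conjI o) (use True x in simp_all)
  next
    case False
    let ?K = "inv_into U \<phi> ` K"
    have "compact ?K"
      using K chart_props(4)[OF c] by (intro compact_continuous_image) (auto intro: continuous_on_subset)
    then have o: "open (\<psi> ` V \<inter> ?q -` (- ?K))" (is "open ?T") using opn compact_imp_closed by blast
    have "Ck_on k ?T (extend U \<phi> u \<circ> ?q)"
    proof (rule Ck_on_cong[OF o Ck_on_const])
      fix y assume y: "y \<in> ?T"
      then show "0 = (extend U \<phi> u \<circ> ?q) y"
        using K(3) chart_props(5)[OF c] by (auto simp: extend_def) (metis imageI)
    qed
    moreover have "?q x \<notin> ?K" using False K(2) chart_props(7)[OF c] by auto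
    ultimately show ?thesis using o x by blast
  qed
qed

definition partial :: "'a set \<Rightarrow> ('a \<Rightarrow> real^'m) \<Rightarrow> ('a \<Rightarrow> real) \<Rightarrow> 'm \<Rightarrow> real^'m \<Rightarrow> real"
  where "partial U \<phi> f i x = frechet_derivative (f \<circ> inv_into U \<phi>) (at x) (axis i 1)"

lemma smooth_has_derivative:
  assumes "(U, \<phi>) \<in> A" "f \<in> SF" "x \<in> \<phi> ` U"
  shows "((f \<circ> inv_into U \<phi>) has_derivative frechet_derivative (f \<circ> inv_into U \<phi>) (at x)) (at x)"
  using smooth_in_chart[OF assms(2,1)] assms(3) Ck_on_Suc_derivative unfolding Cinf_on_def by blast

lemma Cinf_partial:
  assumes "(U, \<phi>) \<in> A" "f \<in> SF" shows "Cinf_on (\<phi> ` U) (partial U \<phi> f i)"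
  using smooth_in_chart[OF assms(2,1)] unfolding Cinf_on_def partial_def[abs_def] by (metis Ck_on.simps(2))

lemma partial_eqI:
  "((f \<circ> inv_into U \<phi>) has_derivative D) (at x) \<Longrightarrow> partial U \<phi> f i x = D (axis i 1)"
  unfolding partial_def by (simp add: frechet_derivative_at[symmetric])

lemma partial_add:
  assumes c: "(U, \<phi>) \<in> A" and "f \<in> SF" "h \<in> SF" and x: "x \<in> \<phi> ` U"
  shows "partial U \<phi> (f + h) i x = partial U \<phi> f i x + partial U \<phi> h i x"
  using partial_eqI[of "f + h" U \<phi>, unfolded plus_fun_def o_def, OF has_derivative_add[OF smooth_has_derivative[OF c assms(2) x, unfolded o_def] smooth_has_derivative[OF c assms(3) x, unfolded o_def]]]
  by (simp add: partial_def o_def plus_fun_def)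

lemma partial_mult:
  assumes c: "(U, \<phi>) \<in> A" and "f \<in> SF" "h \<in> SF" and x: "x \<in> \<phi> ` U"
  shows "partial U \<phi> (f * h) i x = f (inv_into U \<phi> x) * partial U \<phi> h i x + h (inv_into U \<phi> x) * partial U \<phi> f i x"
  using partial_eqI[of "f * h" U \<phi>, unfolded times_fun_def o_def, OF has_derivative_mult[OF smooth_has_derivative[OF c assms(2) x, unfolded o_def] smooth_has_derivative[OF c assms(3) x, unfolded o_def]]]
  by (simp add: partial_def o_def times_fun_def)

lemma partial_const: "partial U \<phi> (\<lambda>_. c) i x = 0"
  by (simp add: partial_def o_def)

lemma partial_cmult:
  assumes c: "(U, \<phi>) \<in> A" and "f \<in> SF" and x: "x \<in> \<phi> ` U"
  shows "partial U \<phi> (\<lambda>q. k * f q) i x = k * partial U \<phi> f i x"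
  using partial_mult[OF c smooth_const[of k] assms(2) x, of i] by (simp add: times_fun_def partial_const)

lemma partial_extend:
  assumes c: "(U, \<phi>) \<in> A" and x: "x \<in> \<phi> ` U" and D: "(u has_derivative D) (at x)"
  shows "partial U \<phi> (extend U \<phi> u) i x = D (axis i 1)"
proof (rule partial_eqI)
  show "((extend U \<phi> u \<circ> inv_into U \<phi>) has_derivative D) (at x)"
    by (rule has_derivative_transform_within_open[OF D chart_props(2)[OF c] x])
      (use chart_props[OF c] in \<open>auto simp: extend_def\<close>)
qed

lemma tangentD:
  assumes "v \<in> tangent_space A p"
  shows "f \<in> SF \<Longrightarrow> h \<in> SF \<Longrightarrow> v (f + h) = v f + v h"
    "f \<in> SF \<Longrightarrow> v (\<lambda>q. c * f q) = c * v f"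
    "f \<in> SF \<Longrightarrow> h \<in> SF \<Longrightarrow> v (f * h) = f p * v h + h p * v f"
    "f \<notin> SF \<Longrightarrow> v f = 0"
  using assms by (auto simp: tangent_space_def)

lemma tangent_sum:
  assumes "v \<in> tangent_space A p" "finite I" "\<And>i. i \<in> I \<Longrightarrow> f i \<in> SF"
  shows "v (sum f I) = (\<Sum>i\<in>I. v (f i))"
  using assms(2,3)
proof (induction I rule: finite_induct)
  case empty
  have "v (\<lambda>q. 0 * 0 q) = 0 * v 0" using tangentD(2)[OF assms(1) smooth_zero] .
  then show ?case by (simp add: zero_fun_def)
next
  case (insert x F)
  then have "v (f x + sum f F) = v (f x) + v (sum f F)"
    by (intro tangentD(1)[OF assms(1)] smooth_sum) auto
  then show ?case
    by (simp only: sum.insert[OF insert.hyps(1,2)]) (use insert in auto)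
qed

text \<open>A derivation kills constants, and at \<open>p\<close> it kills products of two functions vanishing at \<open>p\<close>. By
Hadamard's lemma a smooth function is, up to such products, an affine function of the coordinates.
The formula of that lemma is valid only near \<open>p\<close>; multiplying it by the square of a cutoff, one
factor for the coordinate and one for the coefficient, makes it an identity between global smooth
functions.\<close>

lemma tangent_vector_partials:
  assumes c: "(U, \<phi>) \<in> A" and p: "p \<in> U" and v: "v \<in> tangent_space A p"
  obtains t :: "real^'m" where "\<And>f. f \<in> SF \<Longrightarrow> v f = (\<Sum>i\<in>UNIV. t $ i * partial U \<phi> f i (\<phi> p))"
proof -
  let ?a = "\<phi> p"
  have aU: "?a \<in> \<phi> ` U" using p by simp
  obtain r where r: "r > 0" "ball ?a r \<subseteq> \<phi> ` U"
    using chart_props(2)[OF c] aU open_contains_ball by blast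
  let ?B = "ball ?a r"
  have aB: "?a \<in> ?B" using r by simp
  obtain \<beta> K where \<beta>: "Cinf_on UNIV \<beta>" "compact K" "K \<subseteq> ?B" "\<And>x. x \<notin> K \<Longrightarrow> \<beta> x = (0::real)" "\<beta> ?a = 1"
    using ex_cutoff[OF open_ball aB] by blast
  have KU: "K \<subseteq> \<phi> ` U" using \<beta>(3) r(2) by blast
  have sm: "extend U \<phi> (\<lambda>x. \<beta> x * u x) \<in> SF" if "Cinf_on ?B u" for u
  proof (rule extend_smooth[OF c _ \<beta>(2) KU])
    have "Cinf_on ?B (\<lambda>x. \<beta> x * u x)"
      using that \<beta>(1) Ck_on_subset[OF _ subset_UNIV] unfolding Cinf_on_def by (blast intro: Ck_on_mult)
    then show "Cinf_on UNIV (\<lambda>x. \<beta> x * u x)"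
      by (rule Cinf_on_zero_extend[rotated]) (use \<beta> compact_imp_closed in auto)
  qed (use \<beta>(4) in auto)
  define \<eta> where "\<eta> = extend U \<phi> \<beta>"
  define y where "y i = extend U \<phi> (\<lambda>x. \<beta> x * ((x - ?a) \<bullet> axis i 1))" for i
  have \<eta>: "\<eta> \<in> SF" "\<eta> p = 1"
    unfolding \<eta>_def using extend_smooth[OF c \<beta>(1,2) KU \<beta>(4)] \<beta>(5) p by (auto simp: extend_def)
  have "Ck_on k ?B (\<lambda>x. (x - ?a) \<bullet> axis i 1)" for i k
  proof -
    have "Ck_on k ?B (\<lambda>x. x \<bullet> axis i 1)"
      by (rule Ck_on_bounded_linear) (auto intro: bounded_linear_inner_left)
    then have "Ck_on k ?B (\<lambda>x. x \<bullet> axis i 1 + (- (?a \<bullet> axis i 1)))"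
      by (intro Ck_on_add Ck_on_const) auto
    then show ?thesis by (simp add: inner_diff_left)
  qed
  then have y: "y i \<in> SF" "y i p = 0" for i
    unfolding y_def by (auto intro!: sm simp: Cinf_on_def) (auto simp: extend_def)
  \<comment> \<open>The coefficients are the values of the derivation on the cut-off coordinate functions.\<close>
  show ?thesis
  proof (rule that[of "\<chi> i. v (y i)"])
    fix f assume f: "f \<in> SF"
    let ?f = "f \<circ> inv_into U \<phi>"
    have "Cinf_on ?B ?f"
      using smooth_in_chart[OF f c] r(2) Ck_on_subset unfolding Cinf_on_def by blast
    then obtain G where G: "\<And>b. Cinf_on ?B (G b)"
      "\<And>x. x \<in> ?B \<Longrightarrow> ?f x = ?f ?a + (\<Sum>b\<in>Basis. ((x - ?a) \<bullet> b) * G b x)"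
      "\<And>b. G b ?a = frechet_derivative ?f (at ?a) b"
      using Hadamard[OF open_ball convex_ball aB] by blast
    define g where "g i = extend U \<phi> (\<lambda>x. \<beta> x * G (axis i 1) x)" for i
    have g: "g i \<in> SF" "g i p = partial U \<phi> f i ?a" for i
      unfolding g_def using sm[OF G(1)] p by (auto simp: extend_def \<beta>(5) G(3) partial_def)
    have eq: "\<eta> * \<eta> * f = (\<lambda>q. f p * (\<eta> * \<eta>) q) + (\<Sum>i\<in>UNIV. y i * g i)"
    proof
      fix q
      show "(\<eta> * \<eta> * f) q = ((\<lambda>q. f p * (\<eta> * \<eta>) q) + (\<Sum>i\<in>UNIV. y i * g i)) q"
      proof (cases "q \<in> U \<and> \<phi> q \<in> K")
        case True
        then have qB: "\<phi> q \<in> ?B" using \<beta>(3) by blast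
        have "f q = f p + (\<Sum>i\<in>UNIV. ((\<phi> q - ?a) \<bullet> axis i 1) * G (axis i 1) (\<phi> q))"
          using G(2)[OF qB] True p chart_props(5)[OF c] by (simp add: sum_Basis_axis)
        then show ?thesis
          using True by (simp add: \<eta>_def y_def g_def extend_def sum_fun_apply sum_distrib_left algebra_simps)
      next
        case False
        then have "\<eta> q = 0" "y i q = 0" for i using \<beta>(4) by (auto simp: \<eta>_def y_def extend_def)
        then show ?thesis by (simp add: sum_fun_apply)
      qed
    qed
    have "v (\<eta> * \<eta> * f) = v f + f p * v (\<eta> * \<eta>)"
      using tangentD(3)[OF v smooth_mult[OF \<eta>(1) \<eta>(1)] f] \<eta>(2) by simp
    moreover have "v (\<eta> * \<eta> * f) = f p * v (\<eta> * \<eta>) + (\<Sum>i\<in>UNIV. v (y i * g i))"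
      unfolding eq
      using tangentD(1)[OF v smooth_cmult[OF smooth_mult[OF \<eta>(1) \<eta>(1)]] smooth_sum[of UNIV "\<lambda>i. y i * g i"]]
        tangentD(2)[OF v smooth_mult[OF \<eta>(1) \<eta>(1)]] tangent_sum[OF v, of UNIV "\<lambda>i. y i * g i"]
        smooth_mult[OF y(1) g(1)] by simp
    moreover have "v (y i * g i) = v (y i) * partial U \<phi> f i ?a" for i
      using tangentD(3)[OF v y(1) g(1), of i i] y(2) g(2) by simp
    ultimately show "v f = (\<Sum>i\<in>UNIV. (\<chi> i. v (y i)) $ i * partial U \<phi> f i ?a)" by simp
  qed
qed

lemma vfD:
  assumes "X \<in> VF"
  shows "f \<in> SF \<Longrightarrow> X f \<in> SF"
    "f \<in> SF \<Longrightarrow> h \<in> SF \<Longrightarrow> X (f + h) = X f + X h"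
    "f \<in> SF \<Longrightarrow> X (\<lambda>q. c * f q) = (\<lambda>q. c * X f q)"
    "f \<in> SF \<Longrightarrow> h \<in> SF \<Longrightarrow> X (f * h) = f * X h + h * X f"
    "f \<notin> SF \<Longrightarrow> X f = 0"
  using assms unfolding vector_fields_def by blast+

lemma vf_at_point: "X \<in> VF \<Longrightarrow> at_point X p \<in> tangent_space A p"
  by (auto simp: tangent_space_def at_point_def vfD)

lemma vf_diff_smooth:
  assumes "X \<in> VF" "f \<in> SF" "h \<in> SF" shows "X (f - h) = X f - X h"
  using vfD(2)[OF assms(1) smooth_diff[OF assms(2,3)] assms(3)] by simp

lemma vf_zero_smooth: "X \<in> VF \<Longrightarrow> X 0 = 0"
  using vfD(2)[of X 0 0] smooth_zero by simp

lemma vf_const: "X \<in> VF \<Longrightarrow> X (\<lambda>_. c) = 0"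
proof -
  assume X: "X \<in> VF"
  have "X 1 = 0"
    using vfD(4)[OF X smooth_const[of 1] smooth_const[of 1]] by (simp add: one_fun_def[symmetric])
  then show ?thesis using vfD(3)[OF X smooth_const[of 1], of c] by (simp add: one_fun_def zero_fun_def)
qed

lemma vf_zero: "0 \<in> VF"
  by (auto simp: vector_fields_def smooth_zero)

lemma vf_add: "X \<in> VF \<Longrightarrow> Y \<in> VF \<Longrightarrow> X + Y \<in> VF"
  unfolding vector_fields_def[of A]
  by (auto simp: vfD smooth_add fun_eq_iff algebra_simps)

lemma vf_scale: "f \<in> SF \<Longrightarrow> X \<in> VF \<Longrightarrow> f \<odot> X \<in> VF"
  unfolding vector_fields_def[of A] vscale_def
  by (auto simp: vfD smooth_mult fun_eq_iff algebra_simps)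

lemma vf_cscale: "X \<in> VF \<Longrightarrow> cscale c X \<in> VF"
  unfolding cscale_def by (rule vf_scale[OF smooth_const])

lemma vf_uminus: "X \<in> VF \<Longrightarrow> - X \<in> VF"
proof -
  have "- X = cscale (-1) X" by (simp add: cscale_def vscale_def fun_eq_iff)
  then show "X \<in> VF \<Longrightarrow> - X \<in> VF" using vf_cscale by metis
qed

lemma vf_diff: "X \<in> VF \<Longrightarrow> Y \<in> VF \<Longrightarrow> X - Y \<in> VF"
  using vf_add[OF _ vf_uminus[of Y]] by simp

lemma vf_sum: "(\<And>i. i \<in> I \<Longrightarrow> X i \<in> VF) \<Longrightarrow> sum X I \<in> VF"
  by (induction I rule: infinite_finite_induct) (auto intro: vf_zero vf_add)

lemma vf_bracket:
  assumes X: "X \<in> VF" and Y: "Y \<in> VF" shows "lie_bracket X Y \<in> VF"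
  unfolding vector_fields_def lie_bracket_def
proof (intro CollectI conjI ballI allI impI)
  fix f h and c :: real assume f: "f \<in> SF" and h: "h \<in> SF"
  have [simp]: "X f \<in> SF" "X h \<in> SF" "Y f \<in> SF" "Y h \<in> SF" using f h vfD(1)[OF X] vfD(1)[OF Y] by auto
  note s = vfD(2-4)[OF X] vfD(2-4)[OF Y] smooth_mult
  show "(X (Y f) - Y (X f)) \<in> SF" using vfD(1)[OF X] vfD(1)[OF Y] by (auto intro!: smooth_diff)
  show "X (Y (f + h)) - Y (X (f + h)) = X (Y f) - Y (X f) + (X (Y h) - Y (X h))"
    by (simp add: s f h)
  show "X (Y (\<lambda>q. c * f q)) - Y (X (\<lambda>q. c * f q)) = (\<lambda>q. c * (X (Y f) - Y (X f)) q)"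
    by (simp add: s f fun_eq_iff algebra_simps)
  show "X (Y (f * h)) - Y (X (f * h)) = f * (X (Y h) - Y (X h)) + h * (X (Y f) - Y (X f))"
    by (simp add: s f h fun_eq_iff algebra_simps)
next
  fix f assume "f \<notin> SF"
  then show "X (Y f) - Y (X f) = 0" by (simp add: vfD(5)[OF X] vfD(5)[OF Y] vf_zero_smooth X Y)
qed

text \<open>The coordinate field of index \<open>i\<close>, multiplied by a cutoff so that it becomes global.\<close>

definition coord_field :: "'a set \<Rightarrow> ('a \<Rightarrow> real^'m) \<Rightarrow> (real^'m \<Rightarrow> real) \<Rightarrow> 'm \<Rightarrow> 'a vfield"
  where "coord_field U \<phi> \<beta> i f = (if f \<in> SF then extend U \<phi> (\<lambda>x. \<beta> x * partial U \<phi> f i x) else 0)"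

lemma coord_field_vf:
  assumes c: "(U, \<phi>) \<in> A" and \<beta>: "Cinf_on UNIV \<beta>" "compact K" "K \<subseteq> \<phi> ` U" "\<And>x. x \<notin> K \<Longrightarrow> \<beta> x = (0::real)"
  shows "coord_field U \<phi> \<beta> i \<in> VF"
proof -
  have 1: "coord_field U \<phi> \<beta> i f \<in> SF" if f: "f \<in> SF" for f
  proof -
    have "Cinf_on (\<phi> ` U) (\<lambda>x. \<beta> x * partial U \<phi> f i x)"
      using \<beta>(1) Cinf_partial[OF c f] Ck_on_subset[OF _ subset_UNIV] chart_props(2)[OF c]
      unfolding Cinf_on_def by (blast intro: Ck_on_mult)
    then have "Cinf_on UNIV (\<lambda>x. \<beta> x * partial U \<phi> f i x)"
      by (rule Cinf_on_zero_extend[rotated]) (use \<beta> compact_imp_closed chart_props(2)[OF c] in auto)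
    then have "extend U \<phi> (\<lambda>x. \<beta> x * partial U \<phi> f i x) \<in> SF"
      by (rule extend_smooth[OF c _ \<beta>(2,3)]) (use \<beta> in auto)
    then show ?thesis using f by (simp add: coord_field_def)
  qed
  show ?thesis
    unfolding vector_fields_def
    by (intro CollectI conjI ballI allI impI 1) (auto simp: coord_field_def extend_def smooth_add smooth_mult smooth_cmult fun_eq_iff
        partial_add[OF c] partial_mult[OF c] partial_cmult[OF c] chart_props(5)[OF c] algebra_simps)
qed

lemma coord_field_apply:
  "f \<in> SF \<Longrightarrow> q \<in> U \<Longrightarrow> coord_field U \<phi> \<beta> i f q = \<beta> (\<phi> q) * partial U \<phi> f i (\<phi> q)"
  "q \<notin> U \<Longrightarrow> coord_field U \<phi> \<beta> i f q = 0"
  "f \<notin> SF \<Longrightarrow> coord_field U \<phi> \<beta> i f q = 0"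
  by (auto simp: coord_field_def extend_def)

text \<open>In the chart \<open>X\<close> is a combination of coordinate fields, but its coefficients are not global
functions. If \<open>\<eta>\<close> is the transported cutoff and \<open>y j\<close> the transported product of the cutoff
with the \<open>j\<close>-th coordinate, then by the Leibniz rule \<open>\<eta> X(y j) - y j X(\<eta>)\<close> is a global smooth
function equal to \<open>\<eta>\<^sup>2\<close> times the \<open>j\<close>-th coefficient of \<open>X\<close>. Together with the cutoff inside
\<open>E j\<close> this expresses \<open>\<eta>\<^sup>3 X\<close> by global data.\<close>

lemma local_frame:
  obtains E \<eta> where "\<eta> \<in> SF" "\<eta> p = 1" "\<And>i. E i \<in> VF" "frame_at A p E"
    "\<And>X. X \<in> VF \<Longrightarrow> \<exists>\<kappa>. (\<forall>i. \<kappa> i \<in> SF) \<and> \<eta> \<odot> X = (\<Sum>i\<in>UNIV. \<kappa> i \<odot> E i)"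
proof -
  obtain U \<phi> where c: "(U, \<phi>) \<in> A" and p: "p \<in> U" by (rule chart_at)
  let ?a = "\<phi> p"
  have aU: "?a \<in> \<phi> ` U" using p by simp
  obtain \<beta> K where \<beta>: "Cinf_on UNIV \<beta>" "compact K" "K \<subseteq> \<phi> ` U" "\<And>x. x \<notin> K \<Longrightarrow> \<beta> x = (0::real)" "\<beta> ?a = 1"
    using ex_cutoff[OF chart_props(2)[OF c] aU] by blast
  define E where "E = coord_field U \<phi> \<beta>"
  define \<eta> where "\<eta> = extend U \<phi> \<beta>"
  define y where "y j = extend U \<phi> (\<lambda>x. \<beta> x * (x \<bullet> axis j 1))" for j
  have E: "E i \<in> VF" for i unfolding E_def by (rule coord_field_vf[OF c \<beta>(1-4)])
  have \<eta>: "\<eta> \<in> SF" "\<eta> p = 1"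
    unfolding \<eta>_def using extend_smooth[OF c \<beta>(1-4)] \<beta>(5) p by (auto simp: extend_def)
  have y: "y j \<in> SF" for j
    unfolding y_def
  proof (rule extend_smooth[OF c _ \<beta>(2,3)])
    have "Ck_on k UNIV (\<lambda>x. x \<bullet> axis j (1::real))" for k
      by (rule Ck_on_bounded_linear) (auto intro: bounded_linear_inner_left)
    then show "Cinf_on UNIV (\<lambda>x. \<beta> x * (x \<bullet> axis j 1))"
      using \<beta>(1) by (auto simp: Cinf_on_def intro!: Ck_on_mult)
  qed (use \<beta> in auto)
  have D\<beta>: "(\<beta> has_derivative frechet_derivative \<beta> (at x)) (at x)" for x
    using \<beta>(1) Ck_on_Suc_derivative[of 0 UNIV \<beta>] unfolding Cinf_on_def by blast
  have p\<eta>: "partial U \<phi> \<eta> i x = frechet_derivative \<beta> (at x) (axis i 1)" if "x \<in> \<phi> ` U" for i x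
    unfolding \<eta>_def by (rule partial_extend[OF c that D\<beta>])
  have py: "partial U \<phi> (y j) i x = (x \<bullet> axis j 1) * partial U \<phi> \<eta> i x + (if i = j then \<beta> x else 0)"
    if x: "x \<in> \<phi> ` U" for i j x
  proof -
    have "((\<lambda>x. \<beta> x * (x \<bullet> axis j 1)) has_derivative
      (\<lambda>v. \<beta> x * (v \<bullet> axis j 1) + frechet_derivative \<beta> (at x) v * (x \<bullet> axis j 1))) (at x)"
      by (rule has_derivative_mult[OF D\<beta>]) (auto intro!: derivative_eq_intros)
    from partial_extend[OF c x this, of i] show ?thesis
      by (simp add: y_def p\<eta>[OF x] inner_axis_axis)
  qed
  have expand: "\<eta> q ^ 3 * X f q = (\<Sum>j\<in>UNIV. (\<eta> q * X (y j) q - y j q * X \<eta> q) * E j f q)"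
    if X: "X \<in> VF" for X f q
  proof (cases "q \<in> U \<and> f \<in> SF")
    case True
    then have f: "f \<in> SF" and q: "q \<in> U" by auto
    have x: "\<phi> q \<in> \<phi> ` U" using q by simp
    obtain t :: "real^'m" where t: "\<And>f. f \<in> SF \<Longrightarrow> at_point X q f = (\<Sum>i\<in>UNIV. t $ i * partial U \<phi> f i (\<phi> q))"
      using tangent_vector_partials[OF c q vf_at_point[OF X]] by blast
    have "X (y j) q = (\<phi> q \<bullet> axis j 1) * X \<eta> q + t $ j * \<beta> (\<phi> q)" for j
    proof -
      have "X (y j) q = (\<Sum>i\<in>UNIV. t $ i * ((\<phi> q \<bullet> axis j 1) * partial U \<phi> \<eta> i (\<phi> q) + (if i = j then \<beta> (\<phi> q) else 0)))"
        using t[OF y] py[OF x] by (simp add: at_point_def)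
      also have "\<dots> = (\<phi> q \<bullet> axis j 1) * (\<Sum>i\<in>UNIV. t $ i * partial U \<phi> \<eta> i (\<phi> q)) + (\<Sum>i\<in>UNIV. t $ i * (if i = j then \<beta> (\<phi> q) else 0))"
        by (simp add: distrib_left sum.distrib sum_distrib_left mult_ac)
      also have "(\<Sum>i\<in>UNIV. t $ i * (if i = j then \<beta> (\<phi> q) else 0)) = (\<Sum>i\<in>UNIV. (if i = j then t $ i * \<beta> (\<phi> q) else 0))"
        by (rule sum.cong) auto
      also have "\<dots> = t $ j * \<beta> (\<phi> q)" by simp
      finally show ?thesis using t[OF \<eta>(1)] by (simp add: at_point_def)
    qed
    then have "\<eta> q * X (y j) q - y j q * X \<eta> q = \<beta> (\<phi> q) ^ 2 * t $ j" for j
      using q by (simp add: \<eta>_def y_def extend_def algebra_simps power2_eq_square)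
    then have "(\<Sum>j\<in>UNIV. (\<eta> q * X (y j) q - y j q * X \<eta> q) * E j f q) = (\<Sum>j\<in>UNIV. \<beta> (\<phi> q) ^ 3 * (t $ j * partial U \<phi> f j (\<phi> q)))"
      by (intro sum.cong) (auto simp: E_def coord_field_apply(1)[OF f q] power3_eq_cube power2_eq_square)
    also have "\<dots> = \<eta> q ^ 3 * X f q"
      using t[OF f] q by (simp add: at_point_def sum_distrib_left[symmetric] \<eta>_def extend_def)
    finally show ?thesis by simp
  next
    case False
    then have "\<eta> q = 0 \<or> X f = 0" "E j f q = 0" for j
      using vfD(5)[OF X] by (auto simp: \<eta>_def extend_def E_def coord_field_def)
    then show ?thesis by auto
  qed
  show ?thesis
  proof (rule that[of "\<eta> * \<eta> * \<eta>" E])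
    show "\<eta> * \<eta> * \<eta> \<in> SF" using \<eta> by (intro smooth_mult) auto
    show "(\<eta> * \<eta> * \<eta>) p = 1" using \<eta> by simp
    show "E i \<in> VF" for i by fact
    show "\<exists>\<kappa>. (\<forall>i. \<kappa> i \<in> SF) \<and> (\<eta> * \<eta> * \<eta>) \<odot> X = (\<Sum>i\<in>UNIV. \<kappa> i \<odot> E i)" if X: "X \<in> VF" for X
    proof (intro exI conjI allI)
      show "\<eta> * X (y i) - y i * X \<eta> \<in> SF" for i
        using y \<eta> vfD(1)[OF X] by (intro smooth_diff smooth_mult) auto
      show "(\<eta> * \<eta> * \<eta>) \<odot> X = (\<Sum>i\<in>UNIV. (\<eta> * X (y i) - y i * X \<eta>) \<odot> E i)"
        using expand[OF X] by (auto simp: fun_eq_iff vscale_def sum_fun_apply power3_eq_cube mult_ac)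
    qed
    show "frame_at A p E"
      unfolding frame_at_def
    proof (intro conjI allI ballI)
      show "E i \<in> VF" for i by fact
      fix v assume v: "v \<in> tangent_space A p"
      obtain t :: "real^'m" where t: "\<And>f. f \<in> SF \<Longrightarrow> v f = (\<Sum>i\<in>UNIV. t $ i * partial U \<phi> f i (\<phi> p))"
        using tangent_vector_partials[OF c p v] by blast
      have E0: "E i f p = (if f \<in> SF then partial U \<phi> f i ?a else 0)" for i f
        using coord_field_apply(1)[OF _ p] coord_field_apply(3) by (simp add: E_def \<beta>(5))
      show "\<exists>!c::real^'m. v = (\<lambda>f. \<Sum>i\<in>UNIV. c $ i * at_point (E i) p f)"
      proof (rule ex1I[of _ t])
        show "v = (\<lambda>f. \<Sum>i\<in>UNIV. t $ i * at_point (E i) p f)"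
        proof
          fix f show "v f = (\<Sum>i\<in>UNIV. t $ i * at_point (E i) p f)"
            using t[of f] tangentD(4)[OF v, of f] by (cases "f \<in> SF") (simp_all add: at_point_def E0)
        qed
        \<comment> \<open>Uniqueness: the coefficients are recovered by applying \<open>v\<close> to the cut-off coordinates.\<close>
        fix s :: "real^'m" assume s: "v = (\<lambda>f. \<Sum>i\<in>UNIV. s $ i * at_point (E i) p f)"
        have sk: "v (y j) - (?a \<bullet> axis j 1) * v \<eta> = r $ j"
          if r: "\<And>f. f \<in> SF \<Longrightarrow> v f = (\<Sum>i\<in>UNIV. r $ i * partial U \<phi> f i ?a)" for r :: "real^'m" and j
        proof -
          have "v (y j) = (\<Sum>i\<in>UNIV. (?a \<bullet> axis j 1) * (r $ i * partial U \<phi> \<eta> i ?a) + (if i = j then r $ i else 0))"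
            unfolding r[OF y] by (intro sum.cong refl) (auto simp: py[OF aU] \<beta>(5) algebra_simps)
          also have "\<dots> = (?a \<bullet> axis j 1) * v \<eta> + r $ j"
            by (simp add: sum.distrib sum_distrib_left r[OF \<eta>(1)])
          finally show ?thesis by simp
        qed
        have "v f = (\<Sum>i\<in>UNIV. s $ i * partial U \<phi> f i ?a)" if "f \<in> SF" for f
          using that by (subst s) (simp add: at_point_def E0)
        from sk[OF this] sk[OF t] show "s = t" by (metis vec_eq_iff)
      qed
    qed
  qed
qed

text \<open>The cut-off coordinate fields show that all partial derivatives vanish in every chart, so the
function is locally constant.\<close>

lemma smooth_constant:
  assumes conn: "connected (UNIV :: 'a set)" and f: "f \<in> SF" and X0: "\<And>X. X \<in> VF \<Longrightarrow> X f = 0"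
  shows "f p = f q"
proof (rule connected_local_const[OF conn])
  show "\<forall>p\<in>UNIV. \<forall>\<^sub>F q in at p within UNIV. f p = f q"
  proof
    fix p :: 'a
    obtain U \<phi> where c: "(U, \<phi>) \<in> A" and p: "p \<in> U" by (rule chart_at)
    let ?f = "f \<circ> inv_into U \<phi>"
    have D: "(?f has_derivative (\<lambda>v. 0)) (at x)" if x: "x \<in> \<phi> ` U" for x
    proof -
      obtain \<beta> K where \<beta>: "Cinf_on UNIV \<beta>" "compact K" "K \<subseteq> \<phi> ` U" "\<And>x. x \<notin> K \<Longrightarrow> \<beta> x = (0::real)" "\<beta> x = 1"
        using ex_cutoff[OF chart_props(2)[OF c] x] by blast
      have "partial U \<phi> f i x = 0" for i
        using X0[OF coord_field_vf[OF c \<beta>(1-4)], of i] coord_field_apply(1)[OF f, of "inv_into U \<phi> x" U \<phi> \<beta> i]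
          chart_props(6,7)[OF c x] \<beta>(5) by simp
      then have "(\<Sum>b\<in>Basis. (v \<bullet> b) * frechet_derivative ?f (at x) b) = 0" for v
        unfolding sum_Basis_axis partial_def by simp
      then have "frechet_derivative ?f (at x) = (\<lambda>v. 0)"
        using linear_euclidean_expand[OF has_derivative_linear[OF smooth_has_derivative[OF c f x]]]
        by (metis (no_types, lifting))
      then show ?thesis using smooth_has_derivative[OF c f x] by simp
    qed
    obtain r where r: "r > 0" "ball (\<phi> p) r \<subseteq> \<phi> ` U"
      using chart_props(2)[OF c] p open_contains_ball by blast
    have "(?f has_derivative (\<lambda>v. 0)) (at x within ball (\<phi> p) r)" if "x \<in> ball (\<phi> p) r" for x
      using subsetD[OF r(2) that] by (intro has_derivative_at_withinI[OF D])
    then obtain k where "\<forall>x\<in>ball (\<phi> p) r. ?f x = k"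
      using has_derivative_zero_constant[OF convex_ball] by metis
    then have const: "?f x = ?f (\<phi> p)" if "x \<in> ball (\<phi> p) r" for x
      using that r(1) by (metis centre_in_ball)
    have "open (U \<inter> \<phi> -` ball (\<phi> p) r)"
      using chart_props(1,3)[OF c] by (intro continuous_open_preimage) auto
    moreover have "f p = f q" if "q \<in> U \<inter> \<phi> -` ball (\<phi> p) r" for q
      using const[of "\<phi> q"] that chart_props(5)[OF c] p by auto
    ultimately show "\<forall>\<^sub>F q in at p within UNIV. f p = f q"
      using p r(1) by (auto simp: eventually_at_topological)
  qed
qed auto

end

section \<open>The eigenbundles of an almost product structure\<close>

lemma cscale_apply: "cscale c X f p = c * X f p"
  by (simp add: cscale_def vscale_def)

lemma vscale_apply: "(h \<odot> X) f p = h p * X f p"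
  by (simp add: vscale_def)

lemma cscale_cscale: "cscale a (cscale b X) = cscale (a * b) X"
  by (simp add: fun_eq_iff cscale_apply)

text \<open>Combinations of the three vectors are the image of \<open>real^3\<close> under a linear map, which cannot be injective.\<close>

lemma three_vectors_dependent:
  fixes v1 v2 v3 :: "real^'m"
  assumes "CARD('m::finite) < 3"
  obtains r q w where "r *\<^sub>R v1 + q *\<^sub>R v2 + w *\<^sub>R v3 = 0" "r \<noteq> 0 \<or> q \<noteq> 0 \<or> w \<noteq> 0"
proof -
  define L where "L s = s $ 1 *\<^sub>R v1 + s $ 2 *\<^sub>R v2 + s $ 3 *\<^sub>R v3" for s :: "real^3"
  have lin: "linear L"
    by (intro linearI) (simp_all add: L_def algebra_simps)
  have "\<not> inj L"
  proof
    assume "inj L"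
    then have "dim (range L) = dim (UNIV :: (real^3) set)"
      using lin by (intro dim_image_eq) (auto simp: inj_on_subset)
    then show False
      using dim_subset_UNIV_cart[of "range L"] assms by simp
  qed
  then obtain s where "L s = 0" "s \<noteq> 0"
    using linear_injective_0[OF lin] by blast
  then show ?thesis
    using that[of "s $ 1" "s $ 2" "s $ 3"] by (auto simp: L_def vec_eq_iff forall_3)
qed

locale almost_product_manifold = smooth_manifold A
  for A :: "('a::{t2_space,second_countable_topology}, 'm::finite) chart set" +
  fixes P :: "'a endo" and g :: "'a metric"
  assumes almost_product: "riemannian_almost_product A P g"
begin

lemma ex_frame: obtains E where "\<And>i. E i \<in> VF" "frame_at A p E"
  by (rule local_frame[of p]) (rule that)

lemma P_vf: "X \<in> VF \<Longrightarrow> P X \<in> VF"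
  and P_add: "X \<in> VF \<Longrightarrow> Y \<in> VF \<Longrightarrow> P (X + Y) = P X + P Y"
  and P_scale: "f \<in> SF \<Longrightarrow> X \<in> VF \<Longrightarrow> P (f \<odot> X) = f \<odot> P X"
  and P_P: "X \<in> VF \<Longrightarrow> P (P X) = X"
  and g_P_P: "X \<in> VF \<Longrightarrow> Y \<in> VF \<Longrightarrow> g (P X) (P Y) = g X Y"
  using almost_product by (simp_all add: riemannian_almost_product_def endomorphism_field_def)

lemma g_smooth: "X \<in> VF \<Longrightarrow> Y \<in> VF \<Longrightarrow> g X Y \<in> SF"
  and g_sym: "X \<in> VF \<Longrightarrow> Y \<in> VF \<Longrightarrow> g X Y = g Y X"
  and g_add_left: "X \<in> VF \<Longrightarrow> Y \<in> VF \<Longrightarrow> Z \<in> VF \<Longrightarrow> g (X + Y) Z = g X Z + g Y Z"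
  and g_scale_left: "f \<in> SF \<Longrightarrow> X \<in> VF \<Longrightarrow> Y \<in> VF \<Longrightarrow> g (f \<odot> X) Y = f * g X Y"
  and g_pos: "X \<in> VF \<Longrightarrow> at_point X p \<noteq> 0 \<Longrightarrow> g X X p > 0"
  using almost_product by (simp_all add: riemannian_almost_product_def riemannian_metric_def)

lemma g_P_left: "X \<in> VF \<Longrightarrow> Y \<in> VF \<Longrightarrow> g (P X) Y = g X (P Y)"
  using g_P_P[of X "P Y"] by (simp add: P_P P_vf)

lemma P_cscale: "X \<in> VF \<Longrightarrow> P (cscale c X) = cscale c (P X)"
  unfolding cscale_def by (rule P_scale[OF smooth_const])

lemma g_cscale_left: "X \<in> VF \<Longrightarrow> Y \<in> VF \<Longrightarrow> g (cscale c X) Y = (\<lambda>p. c * g X Y p)"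
  unfolding cscale_def using g_scale_left[OF smooth_const] by (simp add: fun_eq_iff)

lemma g_add_right: "X \<in> VF \<Longrightarrow> Y \<in> VF \<Longrightarrow> Z \<in> VF \<Longrightarrow> g X (Y + Z) = g X Y + g X Z"
  using g_sym g_add_left vf_add by metis

lemma g_scale_right: "f \<in> SF \<Longrightarrow> X \<in> VF \<Longrightarrow> Y \<in> VF \<Longrightarrow> g X (f \<odot> Y) = f * g X Y"
  using g_sym g_scale_left vf_scale by metis

lemma g_cscale_right: "X \<in> VF \<Longrightarrow> Y \<in> VF \<Longrightarrow> g X (cscale c Y) = (\<lambda>p. c * g X Y p)"
  using g_sym g_cscale_left vf_cscale by metis

lemma g_zero_left: "X \<in> VF \<Longrightarrow> g 0 X = 0"
  using g_add_left[OF vf_zero vf_zero] by force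

lemma g_uminus_left: "X \<in> VF \<Longrightarrow> Y \<in> VF \<Longrightarrow> g (- X) Y = - g X Y"
  using g_add_left[of X "- X" Y] vf_uminus[of X] g_zero_left by (simp add: eq_neg_iff_add_eq_0 add.commute)

lemma g_diff_left: "X \<in> VF \<Longrightarrow> Y \<in> VF \<Longrightarrow> Z \<in> VF \<Longrightarrow> g (X - Y) Z = g X Z - g Y Z"
  using g_add_left[of X "- Y" Z] vf_uminus g_uminus_left by simp

lemma vf_eq_0I: assumes "X \<in> VF" "\<And>p. g X X p = 0" shows "X = 0"
proof -
  have "at_point X p = 0" for p using g_pos[OF assms(1), of p] assms(2)[of p] by auto
  then show ?thesis by (auto simp: at_point_def fun_eq_iff)
qed

lemma vf_eqI:
  assumes "X \<in> VF" "Y \<in> VF" "\<And>Z p. Z \<in> VF \<Longrightarrow> g X Z p = g Y Z p" shows "X = Y"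
  using vf_eq_0I[OF vf_diff[OF assms(1,2)]] assms by (simp add: g_diff_left vf_diff)

lemma g_sum_left: "(\<And>i. i \<in> I \<Longrightarrow> X i \<in> VF) \<Longrightarrow> Y \<in> VF \<Longrightarrow> g (sum X I) Y = (\<Sum>i\<in>I. g (X i) Y)"
  by (induction I rule: infinite_finite_induct) (auto simp: g_zero_left g_add_left vf_sum)

text \<open>Linearity over the smooth functions makes the metric pointwise: near \<open>p\<close> the field is a combination
of frame fields with coefficients that vanish at \<open>p\<close>.\<close>

lemma g_tensorial:
  assumes X: "X \<in> VF" "at_point X p = 0" and Y: "Y \<in> VF" shows "g X Y p = 0"
proof -
  obtain \<eta> E where E: "\<eta> \<in> SF" "\<eta> p = 1" "\<And>i. E i \<in> VF" "frame_at A p E"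
    "\<And>X. X \<in> VF \<Longrightarrow> \<exists>\<kappa>. (\<forall>i. \<kappa> i \<in> SF) \<and> \<eta> \<odot> X = (\<Sum>i\<in>UNIV. \<kappa> i \<odot> E i)"
  proof (rule local_frame[of p])
  qed (rule that)
  obtain \<kappa> where \<kappa>: "\<And>i. \<kappa> i \<in> SF" "\<eta> \<odot> X = (\<Sum>i\<in>UNIV. \<kappa> i \<odot> E i)" using E(5)[OF X(1)] by blast
  have "at_point X p = (\<lambda>f. \<Sum>i\<in>UNIV. (\<chi> i. \<kappa> i p) $ i * at_point (E i) p f)"
  proof
    fix f
    have "at_point X p f = (\<eta> \<odot> X) f p" using E(2) by (simp add: vscale_apply at_point_def)
    also have "\<dots> = (\<Sum>i\<in>UNIV. \<kappa> i p * E i f p)" unfolding \<kappa>(2) by (simp add: sum_fun_apply vscale_apply)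
    finally show "at_point X p f = (\<Sum>i\<in>UNIV. (\<chi> i. \<kappa> i p) $ i * at_point (E i) p f)"
      by (simp add: at_point_def)
  qed
  moreover have "at_point X p = (\<lambda>f. \<Sum>i\<in>UNIV. (0::real^'m) $ i * at_point (E i) p f)"
    using X(2) by (simp add: fun_eq_iff)
  ultimately have "(\<chi> i. \<kappa> i p) = 0"
    using E(4) vf_at_point[OF X(1), of p] unfolding frame_at_def by blast
  then have \<kappa>0: "\<kappa> i p = 0" for i by (simp add: vec_eq_iff)
  have "g X Y p = g (\<eta> \<odot> X) Y p" using g_scale_left[OF E(1) X(1) Y] E(2) by simp
  also have "\<dots> = (\<Sum>i\<in>UNIV. \<kappa> i p * g (E i) Y p)"
    unfolding \<kappa>(2) using g_sum_left[of UNIV "\<lambda>i. \<kappa> i \<odot> E i" Y] E(3) \<kappa>(1) Y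
    by (simp add: vf_scale g_scale_left sum_fun_apply)
  finally show ?thesis using \<kappa>0 by simp
qed

text \<open>The sections of the eigenbundle of \<open>P\<close>. Only \<open>s = 1\<close> and \<open>s = -1\<close> are of interest; assuming
\<open>s * s = 1\<close> treats both at once.\<close>

definition eig :: "real \<Rightarrow> 'a vfield set"
  where "eig s = {X \<in> VF. P X = cscale s X}"

lemma eigD: "X \<in> eig s \<Longrightarrow> X \<in> VF" "X \<in> eig s \<Longrightarrow> P X = cscale s X"
  by (auto simp: eig_def)

lemma eig_proj: "s * s = 1 \<Longrightarrow> X \<in> VF \<Longrightarrow> X + cscale s (P X) \<in> eig s"
  unfolding eig_def
  by (simp add: vf_add vf_cscale P_vf P_add P_cscale P_P fun_eq_iff cscale_apply algebra_simps)

lemma eig_add: "X \<in> eig s \<Longrightarrow> Y \<in> eig s \<Longrightarrow> X + Y \<in> eig s"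
  unfolding eig_def by (simp add: vf_add P_add fun_eq_iff cscale_apply algebra_simps)

lemma eig_cscale: "X \<in> eig s \<Longrightarrow> cscale c X \<in> eig s"
  unfolding eig_def by (simp add: vf_cscale P_cscale fun_eq_iff cscale_apply)

lemma eig_orthogonal:
  assumes "s * s = 1" "X \<in> eig s" "Y \<in> eig (- s)" shows "g X Y p = 0"
proof -
  have "g X Y p = g (P X) (P Y) p" using assms eigD(1) g_P_P by metis
  also have "\<dots> = - (s * s) * g X Y p"
    using assms eigD by (simp add: g_cscale_left g_cscale_right vf_cscale)
  finally show ?thesis using assms(1) by simp
qed

text \<open>By the hypothesis the projection to the eigenspace at \<open>p\<close> sends \<open>X\<close> to a multiple of \<open>x\<close>, the
factor being \<open>g H\<close> of the projection of \<open>X\<close>. Such a map has trace \<open>g H x\<close>, because \<open>x\<close> is its own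
projection. But the projection is \<open>(I + s P) / 2\<close>, with trace \<open>n\<close>. The contrapositive bounds the rank of an eigenbundle from below:
\<open>x = 0\<close> shows that the rank is positive, a suitable multiple of a covector shows that for
\<open>n \<ge> 2\<close> it is at least two.\<close>

lemma trace_rank_one_eig:
  assumes dim: "CARD('m) = 2 * n" and tr: "trace_zero A P" and s: "s * s = 1"
    and x: "x \<in> eig s" and H: "H \<in> VF"
    and X: "\<And>X. X \<in> eig s \<Longrightarrow> at_point X p = (\<lambda>f. g H X p * x f p)"
  shows "g H x p = real n"
proof -
  obtain E where E: "\<And>i. E i \<in> VF" "frame_at A p E"
    by (rule ex_frame[of p]) blast
  obtain c :: "real^'m" where c: "at_point x p = (\<lambda>f. \<Sum>i\<in>UNIV. c $ i * at_point (E i) p f)"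
    using E(2) vf_at_point[OF eigD(1)[OF x], of p] unfolding frame_at_def by blast
  define t where "t j = g H (E j + cscale s (P (E j))) p" for j
  define a :: "real^'m^'m" where "a = (\<chi> i j. s * (t j * c $ i - (if i = j then 1 else 0)))"
  have PE: "at_point (P (E j)) p = (\<lambda>f. \<Sum>i\<in>UNIV. a $ i $ j * at_point (E i) p f)" for j
  proof
    fix f
    have "E j f p + s * P (E j) f p = t j * x f p"
      using fun_cong[OF X[OF eig_proj[OF s E(1)]], of j f] by (simp add: at_point_def t_def cscale_apply)
    then have "s * s * P (E j) f p = s * (t j * x f p - E j f p)" by algebra
    then have "P (E j) f p = s * (t j * (\<Sum>i\<in>UNIV. c $ i * E i f p) - E j f p)"
      using s fun_cong[OF c, of f] by (simp add: at_point_def)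
    also have "\<dots> = (\<Sum>i\<in>UNIV. s * t j * (c $ i * E i f p)) - (\<Sum>i\<in>UNIV. if i = j then s * E i f p else 0)"
      by (simp add: sum_distrib_left algebra_simps)
    also have "\<dots> = (\<Sum>i\<in>UNIV. a $ i $ j * E i f p)"
      unfolding sum_subtractf[symmetric] by (intro sum.cong) (auto simp: a_def algebra_simps)
    finally show "at_point (P (E j)) p f = (\<Sum>i\<in>UNIV. a $ i $ j * at_point (E i) p f)"
      by (simp add: at_point_def)
  qed
  have "trace a = 0" using tr E(2) PE unfolding trace_zero_def by blast
  moreover have "trace a = s * ((\<Sum>i\<in>UNIV. t i * c $ i) - 2 * real n)"
    by (simp add: trace_def a_def sum_subtractf sum_distrib_left[symmetric] dim)
  moreover have "s \<noteq> 0" using s by auto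
  ultimately have 1: "(\<Sum>i\<in>UNIV. t i * c $ i) = 2 * real n" by simp
  \<comment> \<open>The sum of the \<open>t i * c i\<close> is also the value at \<open>x\<close> of the covector \<open>g Os\<close>, which is twice \<open>g H x\<close>.\<close>
  define Os where "Os = H + cscale s (P H)"
  have Os: "Os \<in> VF" using H by (simp add: Os_def vf_add vf_cscale P_vf)
  have gOs: "g Y Os p = g H (Y + cscale s (P Y)) p" if "Y \<in> VF" for Y
    using that H g_P_left[of Y H] g_sym[of Y "P H"] g_sym[of Y H] g_sym[of "P Y" H]
    by (simp add: Os_def g_add_right g_cscale_right vf_cscale P_vf)
  define y where "y = x + cscale (-1) (\<Sum>i\<in>UNIV. cscale (c $ i) (E i))"
  have sumE: "(\<Sum>i\<in>UNIV. cscale (c $ i) (E i)) \<in> VF" by (intro vf_sum vf_cscale E)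
  have y: "y \<in> VF" unfolding y_def using eigD(1)[OF x] by (intro vf_add vf_cscale sumE)
  have "at_point y p = 0"
    using fun_cong[OF c] by (auto simp: y_def at_point_def cscale_apply sum_fun_apply fun_eq_iff)
  from g_tensorial[OF y this Os]
  have "g x Os p = (\<Sum>i\<in>UNIV. c $ i * g (E i) Os p)"
    using eigD(1)[OF x] sumE Os E(1) g_sum_left[of UNIV "\<lambda>i. cscale (c $ i) (E i)" Os]
    by (simp add: y_def g_add_left g_cscale_left vf_cscale sum_fun_apply)
  also have "\<dots> = 2 * real n"
    unfolding 1[symmetric] by (intro sum.cong) (auto simp: gOs[OF E(1)] t_def)
  also have "g x Os p = 2 * g H x p"
    using gOs[OF eigD(1)[OF x]] x H s
    by (simp add: eigD(2)[OF x] g_add_right g_cscale_right cscale_cscale eigD(1) vf_cscale)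
  finally show ?thesis by simp
qed

lemma eig_nonzero:
  assumes "CARD('m) = 2 * n" "trace_zero A P" "s * s = 1"
  obtains X where "X \<in> eig s" "at_point X p \<noteq> 0"
proof (rule ccontr)
  note witness = that
  assume "\<not> thesis"
  have "at_point X p = (\<lambda>f. g 0 X p * (0 :: 'a vfield) f p)" if "X \<in> eig s" for X
  proof -
    have "at_point X p = 0" using witness[OF that] \<open>\<not> thesis\<close> by blast
    then show ?thesis by (simp add: fun_eq_iff)
  qed
  moreover have "0 \<in> eig s"
    using P_add[OF vf_zero vf_zero] by (simp add: eig_def vf_zero fun_eq_iff cscale_apply)
  ultimately have "g 0 0 p = real n" using trace_rank_one_eig[OF assms _ vf_zero] by blast
  then show False using g_zero_left[OF vf_zero] assms(1) by simp
qed

text \<open>Otherwise every section of the eigenbundle would be proportional to \<open>x\<close> at \<open>p\<close>, with factor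
\<open>g H X / g H x\<close>.\<close>

lemma eig_kernel:
  assumes "CARD('m) = 2 * n" "trace_zero A P" "s * s = 1" "n \<ge> 2"
    and x: "x \<in> eig s" "g H x p \<noteq> 0" and H: "H \<in> VF"
  obtains Z where "Z \<in> eig s" "g H Z p = 0" "at_point Z p \<noteq> 0"
proof (rule ccontr)
  note witness = that
  assume no: "\<not> thesis"
  have "at_point X p = (\<lambda>f. g (cscale (1 / g H x p) H) X p * x f p)" if X: "X \<in> eig s" for X
  proof -
    let ?Z = "X + cscale (- (g H X p / g H x p)) x"
    have Z: "?Z \<in> eig s" by (intro eig_add eig_cscale x X)
    have "g H ?Z p = 0"
      using x eigD(1)[OF X] eigD(1)[OF x(1)] H by (simp add: g_add_right g_cscale_right vf_cscale)
    then have "at_point ?Z p = 0" using witness[OF Z] no by blast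
    then show ?thesis
      using eigD(1)[OF X] H by (auto simp: fun_eq_iff at_point_def cscale_apply g_cscale_left)
  qed
  from trace_rank_one_eig[OF assms(1-3) x(1) vf_cscale[OF H] this]
  have "real n = 1" using x H eigD(1)[OF x(1)] by (simp add: g_cscale_left)
  then show False using assms(4) by simp
qed

text \<open>In dimension two each eigenspace is a line, as the opposite one is nonzero and orthogonal to it.
The identity is proportionality of \<open>X\<close> and \<open>U\<close> in a form that needs no nonzero generator.\<close>

lemma eig_line:
  assumes dim: "CARD('m) = 2" and tr: "trace_zero A P" and s: "s * s = 1"
    and X: "X \<in> eig s" and Y: "Y \<in> VF" and U: "U \<in> eig s" and Z: "Z \<in> VF"
  shows "g X Y p * g U Z p = g U Y p * g X Z p"
proof -
  have s': "(- s) * (- s) = 1" using s by simp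
  obtain y where y: "y \<in> eig (- s)" "at_point y p \<noteq> 0"
    using eig_nonzero[of 1, OF _ tr s'] dim by auto
  note vf = eigD(1)[OF X] eigD(1)[OF U] eigD(1)[OF y(1)]
  obtain E where E: "\<And>i. E i \<in> VF" "frame_at A p E"
    by (rule ex_frame[of p]) blast
  have co: "\<exists>c::real^'m. at_point V p = (\<lambda>f. \<Sum>i\<in>UNIV. c $ i * at_point (E i) p f)" if "V \<in> VF" for V
    using E(2) vf_at_point[OF that, of p] unfolding frame_at_def by blast
  obtain c1 :: "real^'m" where c1: "at_point X p = (\<lambda>f. \<Sum>i\<in>UNIV. c1 $ i * at_point (E i) p f)"
    using co[OF vf(1)] by blast
  obtain c2 :: "real^'m" where c2: "at_point U p = (\<lambda>f. \<Sum>i\<in>UNIV. c2 $ i * at_point (E i) p f)"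
    using co[OF vf(2)] by blast
  obtain c3 :: "real^'m" where c3: "at_point y p = (\<lambda>f. \<Sum>i\<in>UNIV. c3 $ i * at_point (E i) p f)"
    using co[OF vf(3)] by blast
  have "CARD('m) < 3" using dim by simp
  then obtain r q w where rqw: "r *\<^sub>R c1 + q *\<^sub>R c2 + w *\<^sub>R c3 = 0" "r \<noteq> 0 \<or> q \<noteq> 0 \<or> w \<noteq> 0"
    using three_vectors_dependent[of c1 c2 c3] by blast
  have rc: "r * c1 $ i + q * c2 $ i + w * c3 $ i = 0" for i
    using arg_cong[OF rqw(1), of "\<lambda>v. v $ i"] by simp
  define V where "V = cscale r X + cscale q U + cscale w y"
  have V: "V \<in> VF" unfolding V_def by (intro vf_add vf_cscale vf)
  have "at_point V p = 0"
  proof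
    fix f
    have "at_point V p f = (\<Sum>i\<in>UNIV. (r * c1 $ i + q * c2 $ i + w * c3 $ i) * at_point (E i) p f)"
      using fun_cong[OF c1, of f] fun_cong[OF c2, of f] fun_cong[OF c3, of f]
      by (simp add: V_def at_point_def cscale_apply sum_distrib_left sum.distrib algebra_simps)
    then show "at_point V p f = 0 f" by (simp add: rc)
  qed
  then have gV: "r * g X T p + q * g U T p + w * g y T p = 0" if "T \<in> VF" for T
    using g_tensorial[OF V _ that] that vf by (simp add: V_def g_add_left g_cscale_left vf_add vf_cscale)
  have "w * g y y p = 0"
    using gV[OF vf(3)] eig_orthogonal[OF s X y(1)] eig_orthogonal[OF s U y(1)] by simp
  then have w: "w = 0" using g_pos[OF vf(3) y(2)] by simp
  have 1: "r * g X Y p + q * g U Y p = 0" "r * g X Z p + q * g U Z p = 0"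
    using gV[OF Y] gV[OF Z] w by simp_all
  have "r * (g X Y p * g U Z p - g U Y p * g X Z p) = 0" "q * (g X Y p * g U Z p - g U Y p * g X Z p) = 0"
    using 1 by algebra+
  then show ?thesis using rqw(2) w by auto
qed

end

section \<open>Torsion and the first Bianchi identity\<close>

context smooth_manifold begin

lemma vf_ext:
  assumes "X \<in> VF" "Y \<in> VF" "\<And>f. f \<in> SF \<Longrightarrow> X f = Y f" shows "X = Y"
proof
  fix f show "X f = Y f" using assms vfD(5)[of X f] vfD(5)[of Y f] by (cases "f \<in> SF") auto
qed

lemma jacobi_identity:
  assumes "X \<in> VF" "Y \<in> VF" "Z \<in> VF"
  shows "lie_bracket (lie_bracket X Y) Z + lie_bracket (lie_bracket Y Z) X + lie_bracket (lie_bracket Z X) Y = 0"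
proof (rule vf_ext)
  fix f assume f: "f \<in> SF"
  have s: "X f \<in> SF" "Y f \<in> SF" "Z f \<in> SF" using assms vfD(1) f by blast+
  have s2: "X (Y f) \<in> SF" "X (Z f) \<in> SF" "Y (X f) \<in> SF" "Y (Z f) \<in> SF" "Z (X f) \<in> SF" "Z (Y f) \<in> SF"
    using assms vfD(1) s by blast+
  show "(lie_bracket (lie_bracket X Y) Z + lie_bracket (lie_bracket Y Z) X + lie_bracket (lie_bracket Z X) Y) f = 0 f"
    unfolding lie_bracket_def
    by (simp add: vf_diff_smooth[OF assms(1)] vf_diff_smooth[OF assms(2)] vf_diff_smooth[OF assms(3)] s2)
qed (use assms in \<open>auto intro!: vf_add vf_bracket vf_zero\<close>)

lemma bracket_antisym: "lie_bracket X Y = - lie_bracket Y X"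
  by (simp add: lie_bracket_def fun_eq_iff)

lemma bracket_add_left:
  assumes "X \<in> VF" "Y \<in> VF" "Z \<in> VF"
  shows "lie_bracket (X + Y) Z = lie_bracket X Z + lie_bracket Y Z"
proof (rule vf_ext)
  fix f assume "f \<in> SF"
  then show "lie_bracket (X + Y) Z f = (lie_bracket X Z + lie_bracket Y Z) f"
    using vfD(2)[OF assms(3) vfD(1)[OF assms(1)] vfD(1)[OF assms(2)], of f f] by (simp add: lie_bracket_def)
qed (use assms in \<open>auto intro!: vf_add vf_bracket\<close>)

end

locale connection = smooth_manifold A
  for A :: "('a::{t2_space,second_countable_topology}, 'm::finite) chart set" +
  fixes D :: "'a conn"
  assumes linear_connection: "linear_connection A D"
begin

lemma conn_vf: "X \<in> VF \<Longrightarrow> Y \<in> VF \<Longrightarrow> D X Y \<in> VF"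
  and conn_add_left: "X \<in> VF \<Longrightarrow> Y \<in> VF \<Longrightarrow> Z \<in> VF \<Longrightarrow> D (X + Y) Z = D X Z + D Y Z"
  and conn_add_right: "X \<in> VF \<Longrightarrow> Y \<in> VF \<Longrightarrow> Z \<in> VF \<Longrightarrow> D Z (X + Y) = D Z X + D Z Y"
  and conn_scale_right: "f \<in> SF \<Longrightarrow> X \<in> VF \<Longrightarrow> Y \<in> VF \<Longrightarrow> D X (f \<odot> Y) = X f \<odot> Y + f \<odot> D X Y"
  using linear_connection by (auto simp: linear_connection_def)

lemma conn_cscale_right: "X \<in> VF \<Longrightarrow> Y \<in> VF \<Longrightarrow> D X (cscale c Y) = cscale c (D X Y)"
  unfolding cscale_def by (simp add: conn_scale_right smooth_const vf_const) (simp add: vscale_def fun_eq_iff)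

lemma conn_diff_right:
  assumes "X \<in> VF" "Y \<in> VF" "Z \<in> VF" shows "D Z (X - Y) = D Z X - D Z Y"
  using conn_add_right[OF vf_diff[OF assms(1,2)] assms(2,3)] by simp

lemma torsion_vf: "X \<in> VF \<Longrightarrow> Y \<in> VF \<Longrightarrow> torsion D X Y \<in> VF"
  unfolding torsion_def by (intro vf_diff conn_vf vf_bracket)

lemma torsion_antisym: "torsion D X Y = - torsion D Y X"
  unfolding torsion_def using bracket_antisym[of X Y] by simp

lemma torsion_add_left:
  "X \<in> VF \<Longrightarrow> Y \<in> VF \<Longrightarrow> Z \<in> VF \<Longrightarrow> torsion D (X + Y) Z = torsion D X Z + torsion D Y Z"
  unfolding torsion_def by (simp add: conn_add_left conn_add_right bracket_add_left)

lemma torsion_diff_left: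
  assumes "X \<in> VF" "Y \<in> VF" "Z \<in> VF"
  shows "torsion D (X - Y) Z = torsion D X Z - torsion D Y Z"
  using torsion_add_left[OF vf_diff[OF assms(1,2)] assms(2,3)] by simp

text \<open>The usual first Bianchi identity for a connection with torsion, without the covariant derivative
of the torsion. It is the Jacobi identity after all brackets have been expressed by the connection
and its torsion.\<close>

lemma first_Bianchi_parallel_torsion:
  assumes X: "X \<in> VF" and Y: "Y \<in> VF" and Z: "Z \<in> VF" and par: "parallel_torsion A D"
  shows "curvature D X Y Z + curvature D Y Z X + curvature D Z X Y
    = torsion D (torsion D X Y) Z + torsion D (torsion D Y Z) X + torsion D (torsion D Z X) Y"
proof -
  let ?T = "torsion D"
  have TT: "?T (?T U V) W = ?T (D U V) W - ?T (D V U) W - ?T (lie_bracket U V) W"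
    if "U \<in> VF" "V \<in> VF" "W \<in> VF" for U V W
    using that by (simp add: torsion_def[of D U V] torsion_diff_left conn_vf vf_bracket vf_diff)
  have P: "D U (?T V W) = ?T (D U V) W - ?T (D U W) V" if "U \<in> VF" "V \<in> VF" "W \<in> VF" for U V W
  proof -
    have "D U (?T V W) - ?T (D U V) W - ?T V (D U W) = 0"
      using par that unfolding parallel_torsion_def cov_deriv_12_def by blast
    then show ?thesis using torsion_antisym[of V "D U W"] by (simp add: algebra_simps)
  qed
  have R: "curvature D U V W = D U (D V W) - D V (D U W) - D (lie_bracket U V) W" for U V W
    by (rule curvature_def)
  have P': "D U (D V W) - D U (D W V) = ?T (D U V) W - ?T (D U W) V + D U (lie_bracket V W)"
    if "U \<in> VF" "V \<in> VF" "W \<in> VF" for U V W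
  proof -
    have "D U (?T V W) = D U (D V W) - D U (D W V) - D U (lie_bracket V W)"
      using that by (simp add: torsion_def[of D V W] conn_diff_right conn_vf vf_bracket vf_diff)
    then show ?thesis using P[OF that] by (simp add: algebra_simps)
  qed
  have B: "?T (lie_bracket U V) W = D (lie_bracket U V) W - D W (lie_bracket U V) - lie_bracket (lie_bracket U V) W" for U V W
    by (rule torsion_def)
  show ?thesis
    using P'[OF X Y Z] P'[OF Y Z X] P'[OF Z X Y] jacobi_identity[OF X Y Z]
    unfolding R TT[OF X Y Z] TT[OF Y Z X] TT[OF Z X Y] B
    by (simp add: fun_eq_iff algebra_simps) (smt (verit))
qed

end

section \<open>Natural connections of the two-parameter family\<close>

locale natural_family = almost_product_manifold A P g
  for A :: "('a::{t2_space,second_countable_topology}, 'm::finite) chart set" and P g +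
  fixes n :: nat and nab nab' :: "'a conn" and \<Omega> :: "'a vfield" and lam mu :: real
  assumes dim: "CARD('m) = 2 * n"
    and trace: "trace_zero A P"
    and LC: "levi_civita A g nab"
    and dual: "theta_dual A P g nab \<Omega>"
    and natural: "natural_connection A P g nab'"
    and det: "determined_by A n P g nab \<Omega> nab' lam mu"
begin

sublocale connection A nab'
  using natural by unfold_locales (simp add: natural_connection_def)

definition k :: real where "k = 1 / (2 * real n)"

lemma n_nonzero: "n \<noteq> 0"
proof
  assume "n = 0" with dim show False by simp
qed

lemma k_nonzero: "k \<noteq> 0"
  using n_nonzero by (simp add: k_def)

lemma Omega_vf: "\<Omega> \<in> VF"
  and theta_eq: "X \<in> VF \<Longrightarrow> theta A P g nab X = g \<Omega> X"
  using dual by (auto simp: theta_dual_def)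

lemma metric: "X \<in> VF \<Longrightarrow> Y \<in> VF \<Longrightarrow> Z \<in> VF \<Longrightarrow> X (g Y Z) = g (nab' X Y) Z + g Y (nab' X Z)"
  and conn_P: "X \<in> VF \<Longrightarrow> Y \<in> VF \<Longrightarrow> nab' X (P Y) = P (nab' X Y)"
proof -
  assume "X \<in> VF" "Y \<in> VF" "Z \<in> VF"
  then have "X (g Y Z) - g (nab' X Y) Z - g Y (nab' X Z) = 0"
    using natural unfolding natural_connection_def metric_connection_def cov_deriv_metric_def by blast
  then show "X (g Y Z) = g (nab' X Y) Z + g Y (nab' X Z)" by (simp add: algebra_simps)
next
  assume "X \<in> VF" "Y \<in> VF"
  then have "nab' X (P Y) - P (nab' X Y) = 0"
    using natural unfolding natural_connection_def cov_deriv_endo_def by blast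
  then show "nab' X (P Y) = P (nab' X Y)" by simp
qed

lemma conn_eig: "X \<in> VF \<Longrightarrow> Y \<in> eig s \<Longrightarrow> nab' X Y \<in> eig s"
  using conn_P[of X Y] conn_cscale_right[of X Y s] by (simp add: eig_def conn_vf)

lemma family_apply:
  assumes "X \<in> VF" "Y \<in> VF"
  shows "family_connection A n P g nab \<Omega> l m X Y f p = nab X Y f p
    + g X (P Y) p * (l * P \<Omega> f p + m * \<Omega> f p) - (l * g \<Omega> (P Y) p + m * g \<Omega> Y p) * P X f p
    + g X Y p * (l * \<Omega> f p + (m + k) * P \<Omega> f p) - (l * g \<Omega> Y p + (m + k) * g \<Omega> (P Y) p) * X f p"
  using assms by (simp add: family_connection_def Let_def theta_eq P_vf vscale_apply cscale_apply k_def)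

lemma torsion_apply:
  assumes X: "X \<in> VF" and Y: "Y \<in> VF"
  shows "torsion nab' X Y f p
    = (lam * g \<Omega> X p + (mu + k) * g \<Omega> (P X) p) * Y f p - (lam * g \<Omega> Y p + (mu + k) * g \<Omega> (P Y) p) * X f p
    + (lam * g \<Omega> (P X) p + mu * g \<Omega> X p) * P Y f p - (lam * g \<Omega> (P Y) p + mu * g \<Omega> Y p) * P X f p"
proof -
  have "nab' U V = family_connection A n P g nab \<Omega> lam mu U V" if "U \<in> VF" "V \<in> VF" for U V
    using det that by (simp add: determined_by_def same_connection_def)
  moreover have "torsion nab X Y = 0" using LC X Y by (simp add: levi_civita_def)
  from fun_cong[OF fun_cong[OF this, of f], of p]
  have "nab X Y f p - nab Y X f p = lie_bracket X Y f p" by (simp add: torsion_def)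
  moreover have "g Y X = g X Y" "g Y (P X) = g X (P Y)"
    using X Y g_sym g_P_left P_vf by metis+
  ultimately show ?thesis
    by (simp add: torsion_def family_apply X Y algebra_simps)
qed

text \<open>The coefficients of \<open>lam\<close> and \<open>mu\<close> cancel because \<open>P\<close> acts on the two arguments with opposite signs.\<close>

lemma torsion_mixed:
  assumes s: "s * s = 1" and X: "X \<in> eig s" and Y: "Y \<in> eig (- s)"
  shows "torsion nab' X Y = (\<lambda>p. s * k * g \<Omega> X p) \<odot> Y + (\<lambda>p. s * k * g \<Omega> Y p) \<odot> X"
proof (intro ext)
  fix f p
  show "torsion nab' X Y f p = ((\<lambda>p. s * k * g \<Omega> X p) \<odot> Y + (\<lambda>p. s * k * g \<Omega> Y p) \<odot> X) f p"
    using s unfolding torsion_apply[OF eigD(1)[OF X] eigD(1)[OF Y]]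
    by (simp add: eigD(2)[OF X] eigD(2)[OF Y] cscale_apply vscale_apply g_cscale_right Omega_vf eigD(1)[OF X] eigD(1)[OF Y])
      algebra
qed

lemma torsion_same:
  assumes s: "s * s = 1" and X: "X \<in> eig s" and Y: "Y \<in> eig s"
  shows "torsion nab' X Y = (\<lambda>p. (2 * lam + 2 * s * mu + s * k) * g \<Omega> X p) \<odot> Y
    + (\<lambda>p. - (2 * lam + 2 * s * mu + s * k) * g \<Omega> Y p) \<odot> X"
proof (intro ext)
  fix f p
  show "torsion nab' X Y f p = ((\<lambda>p. (2 * lam + 2 * s * mu + s * k) * g \<Omega> X p) \<odot> Y
    + (\<lambda>p. - (2 * lam + 2 * s * mu + s * k) * g \<Omega> Y p) \<odot> X) f p"
    using s unfolding torsion_apply[OF eigD(1)[OF X] eigD(1)[OF Y]]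
    by (simp add: eigD(2)[OF X] eigD(2)[OF Y] cscale_apply vscale_apply g_cscale_right Omega_vf eigD(1)[OF X] eigD(1)[OF Y])
      algebra
qed

lemma torsion_linear:
  assumes "a \<in> SF" "b \<in> SF" "U \<in> VF" "V \<in> VF" "Z \<in> VF"
  shows "torsion nab' (a \<odot> U + b \<odot> V) Z = a \<odot> torsion nab' U Z + b \<odot> torsion nab' V Z"
  using assms
  by (intro ext) (simp add: torsion_apply vf_add vf_scale P_add P_scale P_vf vscale_apply
      g_add_right g_scale_right Omega_vf algebra_simps)

lemma theta_smooth: "X \<in> VF \<Longrightarrow> (\<lambda>p. c * g \<Omega> X p) \<in> SF"
  using smooth_cmult[OF g_smooth[OF Omega_vf]] .

text \<open>By metricity, the covariant derivative of the mixed torsion formula in direction \<open>Z\<close> is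
\<open>s k (g(w, X) Y + g(w, Y) X)\<close> with \<open>w = nab' Z \<Omega>\<close>. Pairing it with an \<open>X\<close> that is nonzero at the
point isolates \<open>g(w, Y)\<close>; this needs both eigenbundles to be nonzero everywhere.\<close>

lemma parallel_Omega:
  assumes par: "parallel_torsion A nab'" and Z: "Z \<in> VF"
  shows "nab' Z \<Omega> = 0"
proof (rule vf_eqI)
  let ?w = "nab' Z \<Omega>"
  have w: "?w \<in> VF" using Z Omega_vf by (rule conn_vf)
  have part: "g ?w Y p = 0" if s: "s * s = 1" and Y: "Y \<in> eig (- s)" for s Y p
  proof -
    obtain X where X: "X \<in> eig s" "at_point X p \<noteq> 0"
      using eig_nonzero[OF dim trace s] by blast
    note vf = eigD(1)[OF X(1)] eigD(1)[OF Y]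
    have m: "Z (g \<Omega> V) q = g ?w V q + g \<Omega> (nab' Z V) q" if "V \<in> VF" for V q
      using metric[OF Z Omega_vf that] by simp
    have "cov_deriv_12 nab' (torsion nab') Z X Y = 0"
      using par Z vf by (auto simp: parallel_torsion_def)
    moreover have "cov_deriv_12 nab' (torsion nab') Z X Y
      = (\<lambda>p. s * k * g ?w X p) \<odot> Y + (\<lambda>p. s * k * g ?w Y p) \<odot> X"
      unfolding cov_deriv_12_def torsion_mixed[OF s X(1) Y] torsion_mixed[OF s conn_eig[OF Z X(1)] Y]
        torsion_mixed[OF s X(1) conn_eig[OF Z Y]]
      using vf Z vfD(3)[OF Z g_smooth[OF Omega_vf]]
      by (simp add: conn_add_right conn_scale_right vf_scale theta_smooth)
        (simp add: fun_eq_iff vscale_apply m algebra_simps)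
    ultimately have "g ((\<lambda>p. s * k * g ?w X p) \<odot> Y + (\<lambda>p. s * k * g ?w Y p) \<odot> X) X p = 0"
      using g_zero_left[OF vf(1)] by simp
    then have "s * k * g ?w X p * g Y X p + s * k * g ?w Y p * g X X p = 0"
      using vf smooth_cmult[OF g_smooth[OF w]] by (simp add: g_add_left g_scale_left vf_scale)
    moreover have "g Y X p = 0" using eig_orthogonal[OF s X(1) Y] g_sym vf by metis
    moreover have "g X X p > 0" using g_pos X vf by blast
    moreover have "s \<noteq> 0" using s by auto
    ultimately show ?thesis using k_nonzero by simp
  qed
  show "?w \<in> VF" by fact
  show "0 \<in> VF" by (rule vf_zero)
  fix Y p assume Y: "Y \<in> VF"
  have "g ?w (Y + cscale 1 (P Y)) p = 0" "g ?w (Y + cscale (-1) (P Y)) p = 0"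
    using part[of "-1"] part[of 1] eig_proj[of 1] eig_proj[of "-1"] Y by auto
  then show "g ?w Y p = g 0 Y p"
    using Y w by (simp add: g_add_right g_cscale_right vf_cscale P_vf g_zero_left)
qed

definition normsq :: "real \<Rightarrow> 'a \<Rightarrow> real"
  where "normsq s = g (\<Omega> + cscale s (P \<Omega>)) (\<Omega> + cscale s (P \<Omega>))"

text \<open>\<open>\<Omega> + s P \<Omega>\<close> is parallel for the metric connection \<open>nab'\<close>.\<close>

lemma normsq_constant:
  assumes conn: "connected (UNIV :: 'a set)" and par: "parallel_torsion A nab'"
  shows "normsq s p = normsq s q"
  unfolding normsq_def
proof (rule smooth_constant[OF conn])
  let ?S = "\<Omega> + cscale s (P \<Omega>)"
  have S: "?S \<in> VF" using Omega_vf by (intro vf_add vf_cscale P_vf)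
  show "g ?S ?S \<in> SF" using S by (rule g_smooth[OF S])
  fix X assume X: "X \<in> VF"
  have P0: "P 0 = 0" using P_add[OF vf_zero vf_zero] by simp
  have "nab' X ?S = 0"
    using X Omega_vf parallel_Omega[OF par X]
    by (simp add: conn_add_right conn_cscale_right conn_P vf_cscale P_vf P0) (simp add: fun_eq_iff cscale_apply)
  then show "X (g ?S ?S) = 0" using metric[OF X S S] g_zero_left[OF S] g_sym[OF S vf_zero] by simp
qed

lemma W_apply: "Y \<in> VF \<Longrightarrow> Z \<in> VF \<Longrightarrow>
    W_tensor A P g nab Y Z p = g \<Omega> (P Y) p * g \<Omega> Z p - g \<Omega> Y p * g \<Omega> (P Z) p"
  by (simp add: W_tensor_def Let_def theta_eq P_vf)

text \<open>Evaluated on \<open>\<Omega>\<close> and \<open>P \<Omega>\<close>, the tensor \<open>W\<close> is, up to a factor, the product of the two squared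
lengths. Pointwise this only says that one of them is zero at each point; constancy makes it the
same one everywhere.\<close>

lemma W_zero_cases:
  assumes conn: "connected (UNIV :: 'a set)" and par: "parallel_torsion A nab'"
    and W: "W_zero A P g nab"
  obtains "P \<Omega> = - \<Omega>" | "P \<Omega> = \<Omega>"
proof -
  have O2: "P \<Omega> \<in> VF" using Omega_vf by (rule P_vf)
  have N: "normsq s p = g \<Omega> \<Omega> p + 2 * s * g \<Omega> (P \<Omega>) p + s * s * g \<Omega> \<Omega> p" for s p
    unfolding normsq_def using Omega_vf O2 g_sym[OF O2 Omega_vf] g_P_P[OF Omega_vf Omega_vf]
    by (simp add: g_add_left g_add_right g_cscale_left g_cscale_right vf_add vf_cscale algebra_simps)
  have "g \<Omega> (P \<Omega>) p * g \<Omega> (P \<Omega>) p - g \<Omega> \<Omega> p * g \<Omega> \<Omega> p = 0" for p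
    using W W_apply[OF Omega_vf O2, of p] Omega_vf O2 by (simp add: W_zero_def P_P)
  then have prod: "normsq 1 p * normsq (-1) p = 0" for p
    unfolding N by (simp add: algebra_simps)
  have zero: "\<Omega> + cscale s (P \<Omega>) = 0" if "normsq s undefined = 0" for s
  proof (rule vf_eq_0I)
    show "\<Omega> + cscale s (P \<Omega>) \<in> VF" using Omega_vf O2 by (intro vf_add vf_cscale)
    show "g (\<Omega> + cscale s (P \<Omega>)) (\<Omega> + cscale s (P \<Omega>)) p = 0" for p
      using that normsq_constant[OF conn par, of s p undefined] by (simp add: normsq_def)
  qed
  from prod[of undefined] consider "normsq 1 undefined = 0" | "normsq (-1) undefined = 0" by auto
  then show thesis
  proof cases
    case 1
    from zero[OF this] have "P \<Omega> = - \<Omega>" by (simp add: fun_eq_iff cscale_apply eq_neg_iff_add_eq_0 add.commute)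
    then show thesis by (rule that)
  next
    case 2
    from zero[OF this] have "P \<Omega> = \<Omega>" by (simp add: fun_eq_iff cscale_apply)
    then show thesis by (rule that)
  qed
qed

text \<open>Here \<open>\<theta>(P X) = -\<theta>(X)\<close>, so in the family formula \<open>lam\<close> and \<open>mu\<close> multiply opposite terms and
only their difference remains.\<close>

lemma W3bar_if_P_Omega_minus:
  assumes W1: "W1_manifold A n P g nab" and PO: "P \<Omega> = - \<Omega>"
  shows "W3bar A n P g nab" "determined_by A n P g nab \<Omega> nab' 0 (mu - lam)"
proof -
  have th: "g \<Omega> (P X) = - g \<Omega> X" if "X \<in> VF" for X
    using g_P_left[OF Omega_vf that] g_uminus_left[OF Omega_vf that] PO by simp
  show "W3bar A n P g nab"
    using W1 unfolding W3bar_def W1_manifold_def Let_def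
    by (auto simp: theta_eq P_vf th algebra_simps)
  have "nab' X Y f p = family_connection A n P g nab \<Omega> 0 (mu - lam) X Y f p" if "X \<in> VF" "Y \<in> VF" for X Y f p
  proof -
    have "nab' X Y f p = family_connection A n P g nab \<Omega> lam mu X Y f p"
      using det that by (simp add: determined_by_def same_connection_def)
    then show ?thesis by (simp add: family_apply that th PO algebra_simps)
  qed
  then show "determined_by A n P g nab \<Omega> nab' 0 (mu - lam)"
    by (simp add: determined_by_def same_connection_def fun_eq_iff)
qed

lemma W6bar_if_P_Omega_plus:
  assumes W1: "W1_manifold A n P g nab" and PO: "P \<Omega> = \<Omega>"
  shows "W6bar A n P g nab" "determined_by A n P g nab \<Omega> nab' 0 (mu + lam)"
proof -
  have th: "g \<Omega> (P X) = g \<Omega> X" if "X \<in> VF" for X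
    using g_P_left[OF Omega_vf that] PO by simp
  show "W6bar A n P g nab"
    using W1 unfolding W6bar_def W1_manifold_def Let_def
    by (auto simp: theta_eq P_vf th algebra_simps)
  have "nab' X Y f p = family_connection A n P g nab \<Omega> 0 (mu + lam) X Y f p" if "X \<in> VF" "Y \<in> VF" for X Y f p
  proof -
    have "nab' X Y f p = family_connection A n P g nab \<Omega> lam mu X Y f p"
      using det that by (simp add: determined_by_def same_connection_def)
    then show ?thesis by (simp add: family_apply that th PO algebra_simps)
  qed
  then show "determined_by A n P g nab \<Omega> nab' 0 (mu + lam)"
    by (simp add: determined_by_def same_connection_def fun_eq_iff)
qed

text \<open>If \<open>\<theta>\<close> vanished at \<open>p\<close> on one eigenspace, \<open>\<theta>(P Y)\<close> would be a fixed multiple of \<open>\<theta>(Y)\<close> and \<open>W\<close> would vanish at \<open>p\<close>.\<close>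

lemma W_nonzero_theta:
  assumes "W_tensor A P g nab Y Z p \<noteq> 0" "Y \<in> VF" "Z \<in> VF" and s: "s * s = 1"
  obtains X where "X \<in> eig s" "g \<Omega> X p \<noteq> 0"
proof (rule ccontr)
  note witness = that
  assume no: "\<not> thesis"
  have "g \<Omega> X p + s * g \<Omega> (P X) p = 0" if X: "X \<in> VF" for X
  proof -
    have "g \<Omega> (X + cscale s (P X)) p = 0" using witness[OF eig_proj[OF s X]] no by blast
    then show ?thesis using X Omega_vf by (simp add: g_add_right g_cscale_right vf_cscale P_vf)
  qed
  from this[OF assms(2)] this[OF assms(3)] s
  have "g \<Omega> (P Y) p * g \<Omega> Z p - g \<Omega> Y p * g \<Omega> (P Z) p = 0" by algebra
  then show False using assms(1-3) by (simp add: W_apply)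
qed

text \<open>The cyclic sum of \<open>T(T(X, Y), Z)\<close> is zero. With \<open>X\<close>, \<open>Y\<close> on which \<open>\<theta>\<close> is nonzero at \<open>p\<close> and a
nonzero \<open>Z\<close> in its kernel, the sum is \<open>s k (c - s k) \<theta>(Y) \<theta>(X) Z\<close> at \<open>p\<close>, and
\<open>c - s k = 2 (lam + s mu)\<close>.\<close>

lemma parameter_combination_vanishes:
  assumes n2: "n \<ge> 2" and par: "parallel_torsion A nab'"
    and curv: "riemannian_P_tensor A P (curvature4 g nab')"
    and W: "W_tensor A P g nab U V p \<noteq> 0" "U \<in> VF" "V \<in> VF" and s: "s * s = 1"
  shows "lam + s * mu = 0"
proof -
  let ?T = "torsion nab'"
  have s': "(- s) * (- s) = 1" using s by simp
  obtain X where X: "X \<in> eig s" "g \<Omega> X p \<noteq> 0" by (rule W_nonzero_theta[OF W s])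
  obtain Y where Y: "Y \<in> eig (- s)" "g \<Omega> Y p \<noteq> 0" by (rule W_nonzero_theta[OF W s'])
  obtain Z where Z: "Z \<in> eig s" "g \<Omega> Z p = 0" "at_point Z p \<noteq> 0"
    by (rule eig_kernel[OF dim trace s n2 X Omega_vf])
  note vf = eigD(1)[OF X(1)] eigD(1)[OF Y(1)] eigD(1)[OF Z(1)]
  define c where "c = 2 * lam + 2 * s * mu + s * k"
  have R: "curvature nab' U V W \<in> VF" if "U \<in> VF" "V \<in> VF" "W \<in> VF" for U V W
    unfolding curvature_def using that by (intro vf_diff conn_vf vf_bracket)
  have TT0: "?T (?T X Y) Z + ?T (?T Y Z) X + ?T (?T Z X) Y = 0" (is "?B = 0")
  proof (rule vf_eqI)
    show B: "?B \<in> VF" using vf by (intro vf_add torsion_vf)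
    show "0 \<in> VF" by (rule vf_zero)
    fix V q assume V: "V \<in> VF"
    have "curvature4 g nab' X Y Z V + curvature4 g nab' Y Z X V + curvature4 g nab' Z X Y V = 0"
      using curv vf V unfolding riemannian_P_tensor_def by blast
    then have "g (curvature nab' X Y Z + curvature nab' Y Z X + curvature nab' Z X Y) V = 0"
      using vf V R by (simp add: curvature4_def g_add_left vf_add)
    then show "g ?B V q = g 0 V q"
      unfolding first_Bianchi_parallel_torsion[OF vf par] by (simp add: g_zero_left V)
  qed
  have XY: "?T X Y = (\<lambda>p. s * k * g \<Omega> X p) \<odot> Y + (\<lambda>p. s * k * g \<Omega> Y p) \<odot> X"
    by (rule torsion_mixed[OF s X(1) Y(1)])
  have ZY: "?T Z Y = (\<lambda>p. s * k * g \<Omega> Z p) \<odot> Y + (\<lambda>p. s * k * g \<Omega> Y p) \<odot> Z"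
    by (rule torsion_mixed[OF s Z(1) Y(1)])
  have YZ: "?T Y Z = (\<lambda>p. - s * k * g \<Omega> Y p) \<odot> Z + (\<lambda>p. - s * k * g \<Omega> Z p) \<odot> Y"
    using torsion_mixed[OF s' Y(1), of Z] Z(1) by simp
  have YX: "?T Y X = (\<lambda>p. - s * k * g \<Omega> Y p) \<odot> X + (\<lambda>p. - s * k * g \<Omega> X p) \<odot> Y"
    using torsion_mixed[OF s' Y(1), of X] X(1) by simp
  have XZ: "?T X Z = (\<lambda>p. c * g \<Omega> X p) \<odot> Z + (\<lambda>p. - c * g \<Omega> Z p) \<odot> X"
    using torsion_same[OF s X(1) Z(1)] by (simp add: c_def)
  have ZX: "?T Z X = (\<lambda>p. c * g \<Omega> Z p) \<odot> X + (\<lambda>p. - c * g \<Omega> X p) \<odot> Z"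
    using torsion_same[OF s Z(1) X(1)] by (simp add: c_def)
  have "?T (?T X Y) Z = (\<lambda>p. s * k * g \<Omega> X p) \<odot> ?T Y Z + (\<lambda>p. s * k * g \<Omega> Y p) \<odot> ?T X Z"
    unfolding XY by (rule torsion_linear) (use vf theta_smooth in auto)
  moreover have "?T (?T Y Z) X = (\<lambda>p. - s * k * g \<Omega> Y p) \<odot> ?T Z X + (\<lambda>p. - s * k * g \<Omega> Z p) \<odot> ?T Y X"
    unfolding YZ by (rule torsion_linear) (use vf theta_smooth in blast)+
  moreover have "?T (?T Z X) Y = (\<lambda>p. c * g \<Omega> Z p) \<odot> ?T X Y + (\<lambda>p. - c * g \<Omega> X p) \<odot> ?T Z Y"
    unfolding ZX by (rule torsion_linear) (use vf theta_smooth in blast)+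
  moreover obtain f where f: "Z f p \<noteq> 0" using Z(3) by (auto simp: at_point_def fun_eq_iff)
  ultimately have "s * k * (c - s * k) * g \<Omega> Y p * g \<Omega> X p * Z f p = 0"
    using fun_cong[OF fun_cong[OF TT0, of f], of p] Z(2)
    unfolding XY YZ ZY YX XZ ZX
    by (simp add: vscale_apply algebra_simps)
  moreover have "s \<noteq> 0" using s by auto
  ultimately have "c = s * k" using f X(2) Y(2) k_nonzero by simp
  then show ?thesis unfolding c_def by simp
qed

lemma parameters_vanish:
  assumes "n \<ge> 2" "parallel_torsion A nab'" "riemannian_P_tensor A P (curvature4 g nab')" "\<not> W_zero A P g nab"
  shows "lam = 0" "mu = 0"
proof -
  obtain U V p where W: "U \<in> VF" "V \<in> VF" "W_tensor A P g nab U V p \<noteq> 0"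
    using assms(4) by (auto simp: W_zero_def fun_eq_iff)
  have "lam + 1 * mu = 0" "lam + (-1) * mu = 0"
    using parameter_combination_vanishes[OF assms(1-3) W(3,1,2), of 1]
      parameter_combination_vanishes[OF assms(1-3) W(3,1,2), of "-1"] by auto
  then show "lam = 0" "mu = 0" by auto
qed

text \<open>The parameters enter the family through a vector field \<open>\<Delta>\<close>. On each line bundle of
eigenvectors its two kinds of terms, \<open>g(x, y) \<Omega>\<close> and \<open>\<theta>(y) x\<close>, agree.\<close>

lemma surface_parameters_free:
  assumes "n = 1" shows "determined_by A n P g nab \<Omega> nab' 0 0"
proof -
  have dim2: "CARD('m) = 2" using dim assms by simp
  have "nab' X Y = family_connection A n P g nab \<Omega> 0 0 X Y" if X: "X \<in> VF" and Y: "Y \<in> VF" for X Y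
  proof -
    note vf = X Y Omega_vf P_vf[OF X] P_vf[OF Y] P_vf[OF Omega_vf]
    define \<Delta> where "\<Delta> = g X (P Y) \<odot> (cscale lam (P \<Omega>) + cscale mu \<Omega>)
      + (\<lambda>p. - (lam * g \<Omega> (P Y) p + mu * g \<Omega> Y p)) \<odot> P X
      + g X Y \<odot> (cscale lam \<Omega> + cscale mu (P \<Omega>))
      + (\<lambda>p. - (lam * g \<Omega> Y p + mu * g \<Omega> (P Y) p)) \<odot> X"
    have sm: "(\<lambda>p. - (lam * g \<Omega> V p + mu * g \<Omega> V' p)) \<in> SF" if "V \<in> VF" "V' \<in> VF" for V V'
      using smooth_uminus[OF smooth_add[OF theta_smooth[OF that(1)] theta_smooth[OF that(2)]]]
      by (simp add: fun_Compl_def plus_fun_def)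
    have "\<Delta> = 0"
    proof (rule vf_eqI)
      show "\<Delta> \<in> VF" unfolding \<Delta>_def using vf sm g_smooth by (intro vf_add vf_scale vf_cscale) auto
      show "0 \<in> VF" by (rule vf_zero)
      fix Z p assume Z: "Z \<in> VF"
      have gP: "g (P U) (P V) = g U V" "g (P U) V = g U (P V)" if "U \<in> VF" "V \<in> VF" for U V
        using that g_P_P g_P_left by auto
      \<comment> \<open>Proportionality of the projections of \<open>X\<close> and \<open>\<Omega>\<close> to one eigenline; \<open>\<Delta>\<close> combines both signs.\<close>
      have L: "(2 * g X Y p + 2 * s * g X (P Y) p) * (2 * g \<Omega> Z p + 2 * s * g \<Omega> (P Z) p)
        = (2 * g \<Omega> Y p + 2 * s * g \<Omega> (P Y) p) * (2 * g X Z p + 2 * s * g X (P Z) p)" if s: "s * s = 1" for s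
      proof -
        have h: "g (U + cscale s (P U)) (V + cscale s (P V)) p = 2 * g U V p + 2 * s * g U (P V) p"
          if "U \<in> VF" "V \<in> VF" for U V
          using that s
          by (simp add: g_add_left g_add_right g_cscale_left g_cscale_right vf_add vf_cscale P_vf gP P_P algebra_simps)
        show ?thesis
          using eig_line[OF dim2 trace s eig_proj[OF s X] eigD(1)[OF eig_proj[OF s Y]]
              eig_proj[OF s Omega_vf] eigD(1)[OF eig_proj[OF s Z]], of p]
          unfolding h[OF X Y] h[OF Omega_vf Z] h[OF Omega_vf Y] h[OF X Z] .
      qed
      have "g \<Delta> Z p = g X (P Y) p * (lam * g \<Omega> (P Z) p + mu * g \<Omega> Z p)
        - (lam * g \<Omega> (P Y) p + mu * g \<Omega> Y p) * g X (P Z) p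
        + g X Y p * (lam * g \<Omega> Z p + mu * g \<Omega> (P Z) p)
        - (lam * g \<Omega> Y p + mu * g \<Omega> (P Y) p) * g X Z p"
        unfolding \<Delta>_def using vf Z sm g_smooth
        by (simp add: g_add_left g_scale_left g_cscale_left vf_add vf_scale vf_cscale gP) (simp add: algebra_simps)
      also have "\<dots> = 0" using L[of 1] L[of "-1"] by (simp) algebra
      finally show "g \<Delta> Z p = g 0 Z p" by (simp add: g_zero_left Z)
    qed
    moreover have "nab' X Y = family_connection A n P g nab \<Omega> lam mu X Y"
      using det X Y by (simp add: determined_by_def same_connection_def)
    then have "nab' X Y f p = family_connection A n P g nab \<Omega> 0 0 X Y f p + \<Delta> f p" for f p
      by (simp add: family_apply X Y \<Delta>_def vscale_apply cscale_apply algebra_simps)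
    ultimately show ?thesis by (simp add: fun_eq_iff)
  qed
  then show ?thesis by (simp add: determined_by_def same_connection_def)
qed

lemma W_zero_if_W3bar: "W3bar A n P g nab \<Longrightarrow> W_zero A P g nab"
  by (auto simp: W3bar_def W_zero_def W_tensor_def Let_def fun_eq_iff)

lemma W_zero_if_W6bar: "W6bar A n P g nab \<Longrightarrow> W_zero A P g nab"
  by (auto simp: W6bar_def W_zero_def W_tensor_def Let_def fun_eq_iff)

end

section \<open>The classification\<close>

theorem theorem5p3:
  fixes A :: "('a::{t2_space,second_countable_topology}, 'm::finite) chart set"
    and P :: "'a endo" and g :: "'a metric" and nab nab' :: "'a conn"
    and \<Omega> :: "'a vfield" and n :: nat and lam0 mu0 :: real
  assumes "connected (UNIV :: 'a set)"
    and "CARD('m) = 2 * n"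
    and "riemannian_almost_product A P g"
    and "trace_zero A P"
    and "levi_civita A g nab"
    and "W1_manifold A n P g nab"
    and "theta_dual A P g nab \<Omega>"
    and "natural_connection A P g nab'"
    and "determined_by A n P g nab \<Omega> nab' lam0 mu0"
    and "parallel_torsion A nab'"
    and "riemannian_P_tensor A P (curvature4 g nab')"
  shows "\<exists>lam mu. determined_by A n P g nab \<Omega> nab' lam mu \<and>
    ((lam = 0 \<and> mu = 0 \<and> \<not> W_zero A P g nab \<and>
        same_connection A nab' (D_connection A n P g nab \<Omega>) \<and>
        \<not> W3bar A n P g nab \<and> \<not> W6bar A n P g nab)
   \<or> (lam = 0 \<and> mu = 0 \<and> W_zero A P g nab \<and>
        same_connection A nab' (D_connection A n P g nab \<Omega>) \<and>
        (W3bar A n P g nab \<or> W6bar A n P g nab))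
   \<or> (lam = 0 \<and> mu \<noteq> 0 \<and> W_zero A P g nab \<and>
        (W3bar A n P g nab \<or> W6bar A n P g nab))
   \<or> (lam \<noteq> 0 \<and> mu = 0 \<and> W_zero A P g nab \<and>
        (W3bar A n P g nab \<or> W6bar A n P g nab)))"
proof -
  interpret natural_family A P g n nab nab' \<Omega> lam0 mu0
    using assms by unfold_locales (auto simp: riemannian_almost_product_def)
  have D: "same_connection A nab' (D_connection A n P g nab \<Omega>)" if "determined_by A n P g nab \<Omega> nab' 0 0"
    using that by (simp add: determined_by_def D_connection_def)
  show ?thesis
  proof (cases "W_zero A P g nab")
    case True
    have "\<exists>mu. determined_by A n P g nab \<Omega> nab' 0 mu \<and> (W3bar A n P g nab \<or> W6bar A n P g nab)"
      using W_zero_cases[OF assms(1,10) True] W3bar_if_P_Omega_minus[OF assms(6)] W6bar_if_P_Omega_plus[OF assms(6)] by metis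
    then show ?thesis using True D by metis
  next
    case False
    have "determined_by A n P g nab \<Omega> nab' 0 0"
      using surface_parameters_free parameters_vanish[OF _ assms(10,11) False] assms(9)
      n_nonzero by (cases "n = 1") auto
    then show ?thesis using False D W_zero_if_W3bar W_zero_if_W6bar by metis
  qed
qed

end
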